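(* Let $F$ be a field of characteristic zero, let $\Gamma$ be a groupoid, and let $A=\bigoplus_{g\in\Gamma}A_g$ be a finite dimensional $\Gamma$-graded $F$-algebra (not necessarily associative) with support $\{g_1,\ldots,g_k\}$. Let $\dim A_{g_i}=d_i$ for $1\le i\le k$, and let $d=\dim A=d_1+\cdots+d_k$. Then for every $n\ge 1$ the $n$th graded colength of $A$ satisfies $$l_n^{gr}(A)\le d\,(n+1)^{k+d_1^2+\cdots+d_k^2+d_1+\cdots+d_k}.$$
   Context: Here a groupoid $\Gamma$ is a set with a binary operation (no associativity, commutativity or identity element is assumed). Algebras are over $F$ and not necessarily associative. An algebra $A$ is $\Gamma$-graded if $A=\bigoplus_{g\in\Gamma}A_g$ as a vector space and $A_gA_h\subseteq A_{gh}$ for all $g,h\in\Gamma$. The support is $\mathrm{Supp}\,A=\{g\in\Gamma: A_g\ne 0\}=\{g_1,\ldots,g_k\}$ (distinct elements). Let $F\{X\}$ be the absolutely free (nonassociative) algebra on $X=\bigcup_{g\in\Gamma}X_g$ (disjoint union), each $X_g$ infinite, graded by giving each $x\in X_g$ degree $g$. A polynomial $f(x_1,\ldots,x_m)$ with $x_i\in X_{h_i}$ is a graded identity of $A$ if $f(a_1,\ldots,a_m)=0$ for all $a_i\in A_{h_i}$; $Id^{gr}(A)$ is the ideal of all graded identities of $A$. For integers $n_1,\ldots,n_k\ge 0$ with $n_1+\cdots+n_k=n\geq 1$, let $P_{n_1,\ldots,n_k}$ be the space of multilinear polynomials of total degree $n$ in variables $x^{(i)}_1,\ldots,x^{(i)}_{n_i}\in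 X_{g_i}$, $1\le i\le k$, and let $P_{n_1,\ldots,n_k}(A)=P_{n_1,\ldots,n_k}/(P_{n_1,\ldots,n_k}\cap Id^{gr}(A))$. The group $H=S_{n_1}\times\cdots\times S_{n_k}$ acts on $P_{n_1,\ldots,n_k}(A)$, with $S_{n_i}$ permuting the variables $x^{(i)}_1,\ldots,x^{(i)}_{n_i}$. Write the $H$-character as $$\chi_H(P_{n_1,\ldots,n_k}(A))=\sum_{\lambda^{(1)}\vdash n_1,\ldots,\lambda^{(k)}\vdash n_k}m_{\lambda^{(1)},\ldots,\lambda^{(k)}}\,\chi_{\lambda^{(1)},\ldots,\lambda^{(k)}},$$ where $\chi_{\lambda^{(1)},\ldots,\lambda^{(k)}}$ is the irreducible character of $H$ given by the tuple of partitions (the tensor product of the irreducible $S_{n_i}$-characters $\chi_{\lambda^{(i)}}$) and $m_{\lambda^{(1)},\ldots,\lambda^{(k)}}$ is its multiplicity. The partial colength is $l_{n_1,\ldots,n_k}(A)=\sum_{\lambda^{(1)}\vdash n_1,\ldots,\lambda^{(k)}\vdash n_k}m_{\lambda^{(1)},\ldots,\lambda^{(k)}}$, and the $n$th graded colength is $l_n^{gr}(A)=\sum_{n_1+\cdots+n_k=n}l_{n_1,\ldots,n_k}(A)$, the sum being over nonnegative integers. *)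

theory Defs
  imports Complex_Main "HOL-Library.Poly_Mapping" "HOL-Library.FuncSet"
    "HOL-Combinatorics.Permutations"
begin

section \<open>Traces on quotient spaces\<close>

context vector_space
begin

text \<open>
  For subspaces \<open>W \<subseteq> V\<close> with \<open>V / W\<close> finite dimensional and a linear map \<open>T\<close> preserving both,
  this is the trace of the map induced by \<open>T\<close> on \<open>V / W\<close>: if \<open>C\<close> is a basis of \<open>W\<close> and
  \<open>B \<union> C\<close> (disjoint union) is a basis of \<open>V\<close>, then the cosets of the elements of \<open>B\<close> form a basis
  of \<open>V / W\<close>, and the coordinates of the coset of \<open>T b\<close> are the \<open>B\<close>-coordinates of \<open>T b\<close>
  with respect to \<open>B \<union> C\<close>. The result does not depend on the choice of \<open>B\<close> and \<open>C\<close>.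
\<close>

definition quotient_trace :: "'b set \<Rightarrow> 'b set \<Rightarrow> ('b \<Rightarrow> 'b) \<Rightarrow> 'a" where
  "quotient_trace V W T =
     (let (B, C) = (SOME (B, C). B \<inter> C = {} \<and> independent (B \<union> C) \<and> span C = W \<and> span (B \<union> C) = V)
      in \<Sum>b\<in>B. representation (B \<union> C) (T b) b)"

end


section \<open>Spaces with a distinguished basis\<close>

definition pm_scale :: "'f::field \<Rightarrow> ('k \<Rightarrow>\<^sub>0 'f) \<Rightarrow> ('k \<Rightarrow>\<^sub>0 'f)" where
  "pm_scale c = Poly_Mapping.map ((*) c)"

lemma lookup_pm_scale [simp]:
  "Poly_Mapping.lookup (pm_scale c p) k = c * Poly_Mapping.lookup p k"
  by (simp add: pm_scale_def Poly_Mapping.map.rep_eq when_def)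

global_interpretation pm: vector_space pm_scale
  by unfold_locales (auto intro!: poly_mapping_eqI simp: lookup_add algebra_simps)

text \<open>The linear extension of the map \<open>h\<close> between basis elements.\<close>

definition pm_push :: "('k \<Rightarrow> 'l) \<Rightarrow> ('k \<Rightarrow>\<^sub>0 'f::field) \<Rightarrow> ('l \<Rightarrow>\<^sub>0 'f)" where
  "pm_push h p = (\<Sum>k\<in>Poly_Mapping.keys p. Poly_Mapping.single (h k) (Poly_Mapping.lookup p k))"


section \<open>Irreducible characters of symmetric groups\<close>

text \<open>\<open>S\<^sub>n\<close> acts on \<open>{..<n}\<close>; partitions are weakly decreasing lists of positive parts.\<close>

definition sym_group :: "nat \<Rightarrow> (nat \<Rightarrow> nat) set" where
  "sym_group n = {p. p permutes {..<n}}"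

definition partitions :: "nat \<Rightarrow> nat list set" where
  "partitions n = {\<mu>. sorted_wrt (\<ge>) \<mu> \<and> 0 \<notin> set \<mu> \<and> sum_list \<mu> = n}"

text \<open>
  The standard tableau of shape \<open>\<mu>\<close> in which \<open>0, 1, 2, \<dots>\<close> are filled in row by row:
  \<open>box \<mu> m\<close> is the (row, column) position of the entry \<open>m\<close>.
\<close>

fun box :: "nat list \<Rightarrow> nat \<Rightarrow> nat \<times> nat" where
  "box [] m = (0, m)"
| "box (l # ls) m = (if m < l then (0, m) else apfst Suc (box ls (m - l)))"

definition row_stabilizer :: "nat list \<Rightarrow> (nat \<Rightarrow> nat) set" where
  "row_stabilizer \<mu> =
     {p \<in> sym_group (sum_list \<mu>). \<forall>m < sum_list \<mu>. fst (box \<mu> (p m)) = fst (box \<mu> m)}"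

definition column_stabilizer :: "nat list \<Rightarrow> (nat \<Rightarrow> nat) set" where
  "column_stabilizer \<mu> =
     {p \<in> sym_group (sum_list \<mu>). \<forall>m < sum_list \<mu>. snd (box \<mu> (p m)) = snd (box \<mu> m)}"

text \<open>
  The group algebra \<open>F S\<^sub>n\<close> consists of the \<open>x :: (nat \<Rightarrow> nat) \<Rightarrow>\<^sub>0 'f\<close> with
  \<open>keys x \<subseteq> sym_group n\<close>; its product is the convolution with respect to composition.
\<close>

definition conv ::
  "((nat \<Rightarrow> nat) \<Rightarrow>\<^sub>0 'f::field) \<Rightarrow> ((nat \<Rightarrow> nat) \<Rightarrow>\<^sub>0 'f) \<Rightarrow> ((nat \<Rightarrow> nat) \<Rightarrow>\<^sub>0 'f)" where
  "conv x y = (\<Sum>p\<in>Poly_Mapping.keys x. \<Sum>q\<in>Poly_Mapping.keys y.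
     Poly_Mapping.single (p \<circ> q) (Poly_Mapping.lookup x p * Poly_Mapping.lookup y q))"

definition young_symmetrizer :: "nat list \<Rightarrow> ((nat \<Rightarrow> nat) \<Rightarrow>\<^sub>0 'f::field)" where
  "young_symmetrizer \<mu> = (\<Sum>\<rho>\<in>row_stabilizer \<mu>. \<Sum>\<gamma>\<in>column_stabilizer \<mu>.
     Poly_Mapping.single (\<rho> \<circ> \<gamma>) (of_int (sign \<gamma>)))"

text \<open>The minimal left ideal \<open>F S\<^sub>n e\<close> generated by the Young symmetrizer \<open>e\<close>, and its character.\<close>

definition young_module :: "nat list \<Rightarrow> ((nat \<Rightarrow> nat) \<Rightarrow>\<^sub>0 'f::field) set" where
  "young_module \<mu> = {conv x (young_symmetrizer \<mu>) |x. Poly_Mapping.keys x \<subseteq> sym_group (sum_list \<mu>)}"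

definition irr_char :: "nat list \<Rightarrow> (nat \<Rightarrow> nat) \<Rightarrow> 'f::field" where
  "irr_char \<mu> \<sigma> = pm.quotient_trace (young_module \<mu>) {0} (pm_push (\<lambda>p. \<sigma> \<circ> p))"


section \<open>The free nonassociative algebra\<close>

text \<open>
  Nonassociative monomials; a polynomial is an element of \<open>'v mono \<Rightarrow>\<^sub>0 'f\<close>.
  The graded variables are the pairs \<open>(g, j) :: 'g \<times> nat\<close>, so that \<open>X\<^sub>g = {g} \<times> UNIV\<close>.
\<close>

datatype 'v mono = Var 'v | Prod "'v mono" "'v mono"

primrec leaves :: "'v mono \<Rightarrow> 'v list" where
  "leaves (Var v) = [v]"
| "leaves (Prod s t) = leaves s @ leaves t"

primrec eval_mono :: "('a \<Rightarrow> 'a \<Rightarrow> 'a) \<Rightarrow> ('v \<Rightarrow> 'a) \<Rightarrow> 'v mono \<Rightarrow> 'a" where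
  "eval_mono amul a (Var v) = a v"
| "eval_mono amul a (Prod s t) = amul (eval_mono amul a s) (eval_mono amul a t)"

definition multilinear_polys :: "'v set \<Rightarrow> ('v mono \<Rightarrow>\<^sub>0 'f::field) set" where
  "multilinear_polys V =
     {f. \<forall>t\<in>Poly_Mapping.keys f. distinct (leaves t) \<and> set (leaves t) = V}"


section \<open>Graded algebras and colengths\<close>

text \<open>
  \<open>'g\<close> is the grading groupoid, with operation \<open>gop\<close>, and \<open>gr g\<close> is the component of degree \<open>g\<close>.
\<close>

locale graded_algebra = vector_space scale
  for scale :: "'f::field \<Rightarrow> 'a::ab_group_add \<Rightarrow> 'a" +
  fixes amul :: "'a \<Rightarrow> 'a \<Rightarrow> 'a"
    and gop :: "'g \<Rightarrow> 'g \<Rightarrow> 'g"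
    and gr :: "'g \<Rightarrow> 'a set"
  assumes linear_amul_left: "Vector_Spaces.linear scale scale (\<lambda>x. amul x y)"
    and linear_amul_right: "Vector_Spaces.linear scale scale (\<lambda>y. amul x y)"
    and subspace_gr: "subspace (gr g)"
    and direct_sum:
      "\<exists>!c. finite {g. c g \<noteq> 0} \<and> (\<forall>g. c g \<in> gr g) \<and> x = (\<Sum>g | c g \<noteq> 0. c g)"
    and amul_gr: "x \<in> gr g \<Longrightarrow> y \<in> gr h \<Longrightarrow> amul x y \<in> gr (gop g h)"
begin

definition supp :: "'g set" where
  "supp = {g. gr g \<noteq> {0}}"

definition eval :: "('v \<Rightarrow> 'a) \<Rightarrow> ('v mono \<Rightarrow>\<^sub>0 'f) \<Rightarrow> 'a" where
  "eval a f = (\<Sum>t\<in>Poly_Mapping.keys f. scale (Poly_Mapping.lookup f t) (eval_mono amul a t))"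

definition graded_identities :: "(('g \<times> nat) mono \<Rightarrow>\<^sub>0 'f) set" where
  "graded_identities = {f. \<forall>a. (\<forall>g j. a (g, j) \<in> gr g) \<longrightarrow> eval a f = 0}"

text \<open>
  Tuples indexed by the support are functions on \<open>supp\<close>: \<open>ns\<close> stands for the tuple of the
  \<open>n\<^sub>i\<close>, with \<open>ns g\<^sub>i = n\<^sub>i\<close>, and the variables of degree \<open>g \<in> supp\<close> are
  \<open>(g, 0), \<dots>, (g, ns g - 1)\<close>.
\<close>

definition compositions :: "nat \<Rightarrow> ('g \<Rightarrow> nat) set" where
  "compositions n = {ns \<in> supp \<rightarrow>\<^sub>E UNIV. (\<Sum>g\<in>supp. ns g) = n}"

definition P_space :: "('g \<Rightarrow> nat) \<Rightarrow> (('g \<times> nat) mono \<Rightarrow>\<^sub>0 'f) set" where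
  "P_space ns = multilinear_polys (SIGMA g:supp. {..<ns g})"

definition H_group :: "('g \<Rightarrow> nat) \<Rightarrow> ('g \<Rightarrow> nat \<Rightarrow> nat) set" where
  "H_group ns = (\<Pi>\<^sub>E g\<in>supp. sym_group (ns g))"

definition rename :: "('g \<Rightarrow> nat \<Rightarrow> nat) \<Rightarrow> 'g \<times> nat \<Rightarrow> 'g \<times> nat" where
  "rename \<sigma> = (\<lambda>(g, j). (g, if g \<in> supp then \<sigma> g j else j))"

text \<open>The character of \<open>H\<close> on the quotient of \<open>P_space ns\<close> by the graded identities in it.\<close>

definition char_P :: "('g \<Rightarrow> nat) \<Rightarrow> ('g \<Rightarrow> nat \<Rightarrow> nat) \<Rightarrow> 'f" where
  "char_P ns \<sigma> =
     pm.quotient_trace (P_space ns) (P_space ns \<inter> graded_identities) (pm_push (map_mono (rename \<sigma>)))"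

definition multipartitions :: "('g \<Rightarrow> nat) \<Rightarrow> ('g \<Rightarrow> nat list) set" where
  "multipartitions ns = (\<Pi>\<^sub>E g\<in>supp. partitions (ns g))"

definition irr_char_H :: "('g \<Rightarrow> nat list) \<Rightarrow> ('g \<Rightarrow> nat \<Rightarrow> nat) \<Rightarrow> 'f" where
  "irr_char_H \<Lambda> \<sigma> = (\<Prod>g\<in>supp. irr_char (\<Lambda> g) (\<sigma> g))"

definition are_multiplicities :: "('g \<Rightarrow> nat) \<Rightarrow> (('g \<Rightarrow> nat list) \<Rightarrow> nat) \<Rightarrow> bool" where
  "are_multiplicities ns m \<longleftrightarrow>
     (\<forall>\<sigma>\<in>H_group ns. char_P ns \<sigma> = (\<Sum>\<Lambda>\<in>multipartitions ns. of_nat (m \<Lambda>) * irr_char_H \<Lambda> \<sigma>))"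

text \<open>
  If \<open>'f\<close> has characteristic zero and the algebra is finite dimensional, the multiplicities exist
  and are unique on \<open>multipartitions ns\<close>, since \<open>'f\<close> is a splitting field for \<open>H_group ns\<close> and the
  \<open>irr_char_H \<Lambda>\<close> are the distinct irreducible characters. The value 0 is only a totalization.
\<close>

definition multiplicity :: "('g \<Rightarrow> nat) \<Rightarrow> ('g \<Rightarrow> nat list) \<Rightarrow> nat" where
  "multiplicity ns =
     (if \<exists>m. are_multiplicities ns m then (SOME m. are_multiplicities ns m) else (\<lambda>_. 0))"

definition partial_colength :: "('g \<Rightarrow> nat) \<Rightarrow> nat" where
  "partial_colength ns = (\<Sum>\<Lambda>\<in>multipartitions ns. multiplicity ns \<Lambda>)"

definition graded_colength :: "nat \<Rightarrow> nat" where
  "graded_colength n = (\<Sum>ns\<in>compositions n. partial_colength ns)"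

end

end

theory Submission
  imports Defs
begin

text \<open>
  Modulo graded identities, a multilinear polynomial is the multilinear map that it induces on the
  components of \<open>A\<close>, and such a map is given by few numbers if it is symmetric in large sets of
  variables.  Pairing characters with characters of degree 1 of subgroups turns this into a bound for
  every single multiplicity.

  Let \<open>G\<close> be a product of subgroups of the symmetric groups and \<open>\<epsilon>\<close> a character of \<open>G\<close> with values
  \<open>\<plusminus>1\<close>.  The averaging operator \<open>e = 1/|G| (\<Sum>\<sigma>\<in>G. \<epsilon> \<sigma> \<sigma>)\<close> is idempotent, so its trace on any module
  is the dimension of the image, a natural number (\<open>signed_trace\<close>, from
  \<open>quotient_trace_idempotent\<close>).  Apply this to both sides of the equation
  \<open>char_P ns = (\<Sum>M. m M irr_char_H M)\<close>.  All terms on the right are nonnegative, and the coefficient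
  of \<open>m \<Lambda>\<close> is at least 1 as soon as \<open>e\<close> does not kill the Young modules belonging to \<open>\<Lambda>\<close>.  Therefore
  \<open>m \<Lambda>\<close> is at most the dimension of the space of vectors of \<open>P_space ns / graded_identities\<close> on which
  \<open>G\<close> acts by \<open>\<epsilon>\<close> (\<open>multiplicity_le_card\<close>).  This applies to the row stabilizers of \<open>\<Lambda>\<close> with the
  trivial character, and to the column stabilizers with the sign, because in both cases the
  identity has a positive coefficient in \<open>e\<close> times the Young symmetrizer
  (\<open>average_young_symmetrizer_nonzero\<close>).

  Columns: a polynomial that alternates in more than \<open>d\<^sub>i\<close> variables of degree \<open>g\<^sub>i\<close> is an identity.
  Hence \<open>m \<Lambda> = 0\<close> unless every \<open>\<Lambda> g\<^sub>i\<close> has at most \<open>d\<^sub>i\<close> rows (\<open>multiplicity_zero\<close>).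

  Rows: modulo identities, a polynomial that is symmetric in the variables of every row is
  determined by its values when basis elements are substituted for the variables, and these depend
  only on how often each basis element is used in each row.  For component \<open>i\<close> this is at most
  \<open>d\<^sub>i d\<^sub>i\<close> frequencies between 0 and \<open>n\<close>, and a value has \<open>d\<close> coordinates.  Hence
  \<open>m \<Lambda> \<le> d (n + 1) ^ (d\<^sub>1\<^sup>2 + \<dots> + d\<^sub>k\<^sup>2)\<close> (\<open>multiplicity_le\<close>).

  It remains to count.  There are at most \<open>(n + 1) ^ (d\<^sub>1 + \<dots> + d\<^sub>k)\<close> tuples \<open>\<Lambda>\<close> with so few rows
  and at most \<open>(n + 1) ^ k\<close> tuples \<open>(n\<^sub>1, \<dots>, n\<^sub>k)\<close>, which gives the three parts of the exponent.
\<close>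


section \<open>The trace of an idempotent on a quotient space\<close>

context vector_space
begin

text \<open>
  The pair \<open>(B, C)\<close> chosen in \<open>quotient_trace\<close> depends on \<open>V\<close> and \<open>W\<close> only.  One choice
  therefore serves all operators at the same time, which makes the trace linear.
\<close>

lemma quotient_trace_basis:
  assumes "subspace V" "subspace W" "W \<subseteq> V" "finite S" "V \<subseteq> span S"
  obtains B C where "B \<inter> C = {}" "independent (B \<union> C)" "span C = W" "span (B \<union> C) = V"
    "finite B" "\<And>T. quotient_trace V W T = (\<Sum>b\<in>B. representation (B \<union> C) (T b) b)"
proof -
  define P where "P = (\<lambda>(B, C). B \<inter> C = {} \<and> independent (B \<union> C) \<and> span C = W \<and> span (B \<union> C) = V)"
  obtain C0 where C0: "C0 \<subseteq> W" "independent C0" "W \<subseteq> span C0"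
    using maximal_independent_subset by metis
  obtain D where D: "C0 \<subseteq> D" "D \<subseteq> V" "independent D" "V \<subseteq> span D"
    using maximal_independent_subset_extend[of C0 V] C0 assms(3) by blast
  have "span C0 = W" "span D = V"
    using span_subspace[OF C0(1,3) assms(2)] span_subspace[OF D(2,4) assms(1)] by auto
  moreover have "(D - C0) \<union> C0 = D"
    using D(1) by blast
  ultimately have "P (D - C0, C0)"
    using D(3) by (auto simp: P_def)
  then have "P (SOME x. P x)"
    by (rule someI)
  then obtain B C where BC: "(SOME x. P x) = (B, C)" "P (B, C)"
    by (cases "SOME x. P x") auto
  have "finite B"
  proof -
    have "B \<union> C \<subseteq> span S"
      using BC(2) assms(5) span_superset[of "B \<union> C"] by (auto simp: P_def)
    then show ?thesis
      using independent_span_bound[OF assms(4), of "B \<union> C"] BC(2) by (auto simp: P_def)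
  qed
  moreover have "quotient_trace V W T = (\<Sum>b\<in>B. representation (B \<union> C) (T b) b)" for T
    using BC(1) by (simp add: quotient_trace_def P_def)
  ultimately show ?thesis
    using that[of B C] BC(2) by (auto simp: P_def)
qed

text \<open>
  The coordinate functionals of the fixed basis are linear, so it only has to be checked that they
  are applied inside the span of that basis, where they are defined; the invariance of \<open>V\<close> gives this.
\<close>

lemma quotient_trace_linear_combination:
  assumes VW: "subspace V" "subspace W" "W \<subseteq> V" "finite S" "V \<subseteq> span S"
    and inv: "\<And>i v. i \<in> I \<Longrightarrow> v \<in> V \<Longrightarrow> T i v \<in> V"
  shows "quotient_trace V W (\<lambda>v. \<Sum>i\<in>I. scale (c i) (T i v)) = (\<Sum>i\<in>I. c i * quotient_trace V W (T i))"
proof -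
  obtain B C where BC: "B \<inter> C = {}" "independent (B \<union> C)" "span C = W" "span (B \<union> C) = V" "finite B"
    and tr: "\<And>T. quotient_trace V W T = (\<Sum>b\<in>B. representation (B \<union> C) (T b) b)"
    by (rule quotient_trace_basis[OF VW]) (rule that)
  have "representation (B \<union> C) (\<Sum>i\<in>I. scale (c i) (T i b)) b
      = (\<Sum>i\<in>I. c i * representation (B \<union> C) (T i b) b)" if "b \<in> B" for b
  proof -
    have Tb: "T i b \<in> span (B \<union> C)" if "i \<in> I" for i
      using inv[OF that, of b] \<open>b \<in> B\<close> BC(4) span_base[of b "B \<union> C"] by auto
    then have "representation (B \<union> C) (\<Sum>i\<in>I. scale (c i) (T i b)) b
        = (\<Sum>i\<in>I. representation (B \<union> C) (scale (c i) (T i b)) b)"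
      by (subst representation_sum[OF BC(2)]) (auto intro: span_scale)
    also have "\<dots> = (\<Sum>i\<in>I. c i * representation (B \<union> C) (T i b) b)"
      using Tb by (intro sum.cong refl) (simp add: representation_scale[OF BC(2)])
    finally show ?thesis .
  qed
  then show ?thesis
    by (simp add: tr sum_distrib_left sum.swap[of _ B I])
qed

lemma independent_Un_span_Int:
  assumes "independent (B \<union> C)" "B \<inter> C = {}" "x \<in> span B" "x \<in> span C"
  shows "x = 0"
proof -
  have "representation (B \<union> C) x = representation B x" "representation (B \<union> C) x = representation C x"
    using representation_extend[OF assms(1) assms(3)] representation_extend[OF assms(1) assms(4)] by auto
  then have "representation B x b = 0" for b
    using assms(2) representation_ne_zero[of B x b] representation_ne_zero[of C x b] by (metis disjoint_iff)
  moreover have "independent B"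
    using assms(1) independent_mono by blast
  ultimately show ?thesis
    using sum_nonzero_representation_eq[of B x] assms(3) by simp
qed

text \<open>
  Choose \<open>U \<subseteq> E V\<close> such that the cosets of its elements form a basis of the image of \<open>E\<close> on
  \<open>V / W\<close>, and let \<open>f\<^sub>u v\<close> be the \<open>u\<close>-coordinate of \<open>E v\<close>.  Modulo \<open>W\<close> we have
  \<open>E v = (\<Sum>u\<in>U. f\<^sub>u v u)\<close>, so the trace of \<open>E\<close> is \<open>(\<Sum>u\<in>U. f\<^sub>u u)\<close>, and each summand is 1 because
  \<open>E u = u\<close>.
\<close>

lemma quotient_trace_idempotent:
  assumes VW: "subspace V" "subspace W" "W \<subseteq> V" "finite S" "V \<subseteq> span S"
    and E: "Vector_Spaces.linear scale scale E" "E ` V \<subseteq> V" "E ` W \<subseteq> W"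
    and idem: "\<And>v. v \<in> V \<Longrightarrow> E (E v) = E v"
  obtains U where "finite U" "U \<subseteq> E ` V" "independent U" "span U \<inter> W = {0}"
    "E ` V \<subseteq> span (U \<union> W)" "quotient_trace V W E = of_nat (card U)"
proof -
  interpret E: Vector_Spaces.linear scale scale E by (rule E(1))
  obtain B C where BC: "B \<inter> C = {}" "independent (B \<union> C)" "span C = W" "span (B \<union> C) = V" "finite B"
    and tr: "\<And>T. quotient_trace V W T = (\<Sum>b\<in>B. representation (B \<union> C) (T b) b)"
    by (rule quotient_trace_basis[OF VW]) (rule that)
  have indC: "independent C"
    using BC(2) independent_mono by blast
  obtain D where D: "C \<subseteq> D" "D \<subseteq> C \<union> E ` V" "independent D" "C \<union> E ` V \<subseteq> span D"
    using maximal_independent_subset_extend[of C "C \<union> E ` V"] indC by blast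
  define U where "U = D - C"
  have DU: "D = U \<union> C" "U \<inter> C = {}"
    using D(1) by (auto simp: U_def)
  have UE: "U \<subseteq> E ` V"
    using D(2) by (auto simp: U_def)
  have EU: "E u = u" if "u \<in> U" for u
    using UE that idem by auto
  have UV: "U \<subseteq> V"
    using UE E(2) by auto
  have "finite U"
  proof -
    have "U \<subseteq> span S"
      using UV VW(5) by auto
    moreover have "independent U"
      using D(3) independent_mono[of D U] by (auto simp: U_def)
    ultimately show ?thesis
      using independent_span_bound[OF VW(4)] by blast
  qed
  have ind: "independent U"
    using D(3) independent_mono[of D U] by (auto simp: U_def)
  define f where "f u v = representation D (E v) u" for u v
  have inD: "E v \<in> span D" if "v \<in> V" for v
    using D(4) that by auto
  have f_sum: "f u (\<Sum>i\<in>I. scale (c i) (x i)) = (\<Sum>i\<in>I. c i * f u (x i))"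
    if "\<And>i. i \<in> I \<Longrightarrow> x i \<in> V" for I u c and x :: "'b \<Rightarrow> 'b"
  proof -
    have "f u (\<Sum>i\<in>I. scale (c i) (x i)) = representation D (\<Sum>i\<in>I. scale (c i) (E (x i))) u"
      by (simp add: f_def E.sum E.scale)
    also have "\<dots> = (\<Sum>i\<in>I. representation D (scale (c i) (E (x i))) u)"
      using that inD by (subst representation_sum[OF D(3)]) (auto intro!: span_scale)
    also have "\<dots> = (\<Sum>i\<in>I. c i * f u (x i))"
      using that inD by (intro sum.cong refl) (simp add: representation_scale[OF D(3)] f_def)
    finally show ?thesis .
  qed
  have f_W: "f u w = 0" if "w \<in> W" "u \<in> U" for u w
  proof -
    have "E w \<in> span C"
      using that(1) E(3) BC(3) by auto
    then have "representation D (E w) = representation C (E w)"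
      using D(1,3) by (intro representation_extend) auto
    then show ?thesis
      using representation_ne_zero[of C "E w" u] that(2) by (auto simp: f_def U_def)
  qed
  have f_U: "f u u = 1" if "u \<in> U" for u
    using that by (simp add: f_def EU representation_basis[OF D(3)] U_def)
  \<comment> \<open>Expanding an element of \<open>V\<close> in the basis \<open>B \<union> C\<close>; the part in the span of \<open>C\<close> lies in \<open>W\<close>.\<close>
  have expand: "(\<Sum>b\<in>B. representation (B \<union> C) v b * f u b) = f u v" if "v \<in> V" "u \<in> U" for u v
  proof -
    let ?r = "representation (B \<union> C) v"
    define K where "K = {b. ?r b \<noteq> 0}"
    have K: "finite K" "K \<subseteq> B \<union> C"
      using representation_ne_zero[of "B \<union> C" v] by (auto simp: K_def finite_representation)
    have inV: "b \<in> V" if "b \<in> B \<union> C" for b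
      using that BC(4) span_base by blast
    have "f u v = f u (\<Sum>b\<in>K. scale (?r b) b)"
      using sum_nonzero_representation_eq[OF BC(2), of v] BC(4) that by (simp add: K_def)
    also have "\<dots> = (\<Sum>b\<in>K. ?r b * f u b)"
      using K inV by (intro f_sum) auto
    also have "\<dots> = (\<Sum>b\<in>K \<inter> B. ?r b * f u b)"
    proof (rule sum.mono_neutral_right)
      show "\<forall>b\<in>K - K \<inter> B. ?r b * f u b = 0"
        using K(2) f_W[OF _ that(2)] span_base[of _ C, unfolded BC(3)] by auto
    qed (use K in auto)
    also have "\<dots> = (\<Sum>b\<in>B. ?r b * f u b)"
      by (rule sum.mono_neutral_left) (use BC(5) in \<open>auto simp: K_def\<close>)
    finally show ?thesis ..
  qed
  have Eb: "representation (B \<union> C) (E b) b = (\<Sum>u\<in>U. f u b * representation (B \<union> C) u b)"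
    if "b \<in> B" for b
  proof -
    have bV: "b \<in> V"
      using that BC(4) span_base by blast
    let ?r = "representation D (E b)"
    define K where "K = {d. ?r d \<noteq> 0}"
    have K: "finite K" "K \<subseteq> U \<union> C"
      using representation_ne_zero[of D "E b"] DU by (auto simp: K_def finite_representation)
    have inV: "d \<in> span (B \<union> C)" if "d \<in> U \<union> C" for d
      using that BC(4) UV span_base[of d "B \<union> C"] by auto
    have "representation (B \<union> C) (E b) b = representation (B \<union> C) (\<Sum>d\<in>K. scale (?r d) d) b"
      using sum_nonzero_representation_eq[OF D(3) inD[OF bV]] by (simp add: K_def)
    also have "\<dots> = (\<Sum>d\<in>K. representation (B \<union> C) (scale (?r d) d) b)"
      using K inV by (subst representation_sum[OF BC(2)]) (auto intro!: span_scale)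
    also have "\<dots> = (\<Sum>d\<in>K. ?r d * representation (B \<union> C) d b)"
      using K inV by (intro sum.cong refl) (auto simp add: representation_scale[OF BC(2)])
    also have "\<dots> = (\<Sum>d\<in>K \<inter> U. ?r d * representation (B \<union> C) d b)"
    proof (rule sum.mono_neutral_right)
      have "representation (B \<union> C) d b = 0" if "d \<in> C" for d
        using that \<open>b \<in> B\<close> BC(1) by (auto simp: representation_basis[OF BC(2)])
      then show "\<forall>d\<in>K - K \<inter> U. ?r d * representation (B \<union> C) d b = 0"
        using K(2) by auto
    qed (use K in auto)
    also have "\<dots> = (\<Sum>d\<in>U. ?r d * representation (B \<union> C) d b)"
      by (rule sum.mono_neutral_left) (use \<open>finite U\<close> in \<open>auto simp: K_def\<close>)
    finally show ?thesis
      by (simp add: f_def)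
  qed
  have "quotient_trace V W E = (\<Sum>b\<in>B. \<Sum>u\<in>U. f u b * representation (B \<union> C) u b)"
    by (simp add: tr Eb)
  also have "\<dots> = (\<Sum>u\<in>U. \<Sum>b\<in>B. representation (B \<union> C) u b * f u b)"
    by (subst sum.swap) (simp add: mult.commute)
  also have "\<dots> = (\<Sum>u\<in>U. f u u)"
    using UV by (intro sum.cong refl expand) auto
  finally have "quotient_trace V W E = of_nat (card U)"
    by (simp add: f_U)
  moreover have "span U \<inter> W = {0}"
    using independent_Un_span_Int[of U C] DU D(3) BC(3) span_zero by auto
  moreover have "E ` V \<subseteq> span (U \<union> W)"
  proof -
    have "C \<subseteq> W"
      using BC(3) span_superset by blast
    then have "span D \<subseteq> span (U \<union> W)"
      unfolding DU(1) by (intro span_mono) auto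
    then show ?thesis
      using D(4) by auto
  qed
  ultimately show ?thesis
    using that \<open>finite U\<close> UE ind by blast
qed

end


section \<open>Linear maps on spaces with a distinguished basis\<close>

lemma single_eq_pm_scale: "Poly_Mapping.single k c = pm_scale c (Poly_Mapping.single k (1::'f::field))"
  by (rule poly_mapping_eqI) (simp add: lookup_single when_def)

lemma pm_expand:
  fixes p :: "'k \<Rightarrow>\<^sub>0 'f::field"
  assumes "finite S" "Poly_Mapping.keys p \<subseteq> S"
  shows "p = (\<Sum>k\<in>S. pm_scale (Poly_Mapping.lookup p k) (Poly_Mapping.single k 1))"
proof (rule poly_mapping_eqI)
  fix k
  show "Poly_Mapping.lookup p k
      = Poly_Mapping.lookup (\<Sum>k\<in>S. pm_scale (Poly_Mapping.lookup p k) (Poly_Mapping.single k 1)) k"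
    using assms by (auto simp: lookup_sum lookup_single when_def if_distrib in_keys_iff cong: if_cong)
qed

lemma pm_subspace_keys: "pm.subspace {p. Poly_Mapping.keys p \<subseteq> S}"
  by (rule pm.subspaceI) (auto simp: in_keys_iff lookup_add dest!: subsetD)

lemma pm_in_span_singles:
  assumes "finite S" "Poly_Mapping.keys p \<subseteq> S"
  shows "p \<in> pm.span ((\<lambda>k. Poly_Mapping.single k 1) ` S)"
  by (subst pm_expand[OF assms]) (auto intro!: pm.span_sum pm.span_scale intro: pm.span_base)

definition linear_extension ::
  "('f::field \<Rightarrow> 'b::ab_group_add \<Rightarrow> 'b) \<Rightarrow> ('k \<Rightarrow> 'b) \<Rightarrow> ('k \<Rightarrow>\<^sub>0 'f) \<Rightarrow> 'b" where
  "linear_extension s f p = (\<Sum>k\<in>Poly_Mapping.keys p. s (Poly_Mapping.lookup p k) (f k))"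

context vector_space
begin

lemma linear_extension_superset:
  fixes p :: "'k \<Rightarrow>\<^sub>0 'a"
  assumes "finite S" "Poly_Mapping.keys p \<subseteq> S"
  shows "linear_extension scale f p = (\<Sum>k\<in>S. scale (Poly_Mapping.lookup p k) (f k))"
  unfolding linear_extension_def
  using assms by (intro sum.mono_neutral_left) (auto simp: in_keys_iff)

lemma linear_linear_extension:
  fixes f :: "'k \<Rightarrow> 'b"
  shows "Vector_Spaces.linear pm_scale scale (linear_extension scale f)"
proof -
  have "linear_extension scale f (p + q) = linear_extension scale f p + linear_extension scale f q" for p q :: "'k \<Rightarrow>\<^sub>0 'a"
  proof -
    let ?S = "Poly_Mapping.keys p \<union> Poly_Mapping.keys q"
    have "finite ?S" "Poly_Mapping.keys (p + q) \<subseteq> ?S"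
      using keys_add[of p q] by auto
    then show ?thesis
      by (simp add: linear_extension_superset[of ?S] lookup_add scale_left_distrib sum.distrib)
  qed
  moreover have "linear_extension scale f (pm_scale c p) = scale c (linear_extension scale f p)" for c and p :: "'k \<Rightarrow>\<^sub>0 'a"
  proof -
    have "Poly_Mapping.keys (pm_scale c p) \<subseteq> Poly_Mapping.keys p"
      by (auto simp: in_keys_iff)
    then show ?thesis
      by (simp add: linear_extension_superset[of "Poly_Mapping.keys p"] scale_sum_right)
  qed
  ultimately show ?thesis
    using pm.vector_space_axioms vector_space_axioms by (simp add: Vector_Spaces.linear_iff)
qed

lemma linear_extension_single: "linear_extension scale f (Poly_Mapping.single k 1) = f k"
  by (simp add: linear_extension_superset[of "{k}"])

lemma pm_linear_eqI:
  fixes p :: "'k \<Rightarrow>\<^sub>0 'a"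
  assumes "Vector_Spaces.linear pm_scale scale f" "Vector_Spaces.linear pm_scale scale g"
    and eq: "\<And>k. f (Poly_Mapping.single k 1) = g (Poly_Mapping.single k 1)"
  shows "f p = g p"
proof -
  interpret f: Vector_Spaces.linear pm_scale scale f by fact
  interpret g: Vector_Spaces.linear pm_scale scale g by fact
  have "f p = f (\<Sum>k\<in>Poly_Mapping.keys p. pm_scale (Poly_Mapping.lookup p k) (Poly_Mapping.single k 1))"
    using pm_expand[of "Poly_Mapping.keys p" p] by simp
  also have "\<dots> = g (\<Sum>k\<in>Poly_Mapping.keys p. pm_scale (Poly_Mapping.lookup p k) (Poly_Mapping.single k 1))"
    by (simp add: f.sum f.scale g.sum g.scale eq)
  also have "\<dots> = g p"
    using pm_expand[of "Poly_Mapping.keys p" p] by simp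
  finally show ?thesis .
qed

end

text \<open>
  The functionals \<open>\<phi> i\<close> are the coordinates of a linear map into a space with basis \<open>X\<close>, and the
  separation hypothesis says that this map is injective on the span of \<open>U\<close>.
\<close>

lemma (in vector_space) independent_card_le_functionals:
  fixes \<phi> :: "'i \<Rightarrow> 'b \<Rightarrow> 'a"
  assumes "finite X" "independent U"
    and lin: "\<And>i. i \<in> X \<Longrightarrow> Vector_Spaces.linear scale (*) (\<phi> i)"
    and sep: "\<And>v. v \<in> span U \<Longrightarrow> (\<And>i. i \<in> X \<Longrightarrow> \<phi> i v = 0) \<Longrightarrow> v = 0"
  shows "card U \<le> card X"
proof -
  define L where "L v = (\<Sum>i\<in>X. Poly_Mapping.single i (\<phi> i v))" for v
  have lookup_L: "Poly_Mapping.lookup (L v) i = (if i \<in> X then \<phi> i v else 0)" for v i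
    using assms(1) by (simp add: L_def lookup_sum lookup_single when_def)
  have phi: "\<phi> i (v + w) = \<phi> i v + \<phi> i w" "\<phi> i (scale c v) = c * \<phi> i v" if "i \<in> X" for i v w c
    using lin[OF that] by (simp_all add: Vector_Spaces.linear_iff)
  have L: "Vector_Spaces.linear scale pm_scale L"
    unfolding Vector_Spaces.linear_iff
    by (intro conjI allI poly_mapping_eqI vector_space_axioms pm.vector_space_axioms)
       (simp_all add: lookup_L lookup_add phi)
  interpret L: Vector_Spaces.linear scale pm_scale L
    by (rule L)
  have "inj_on L (span U)"
  proof (subst L.inj_on_iff_eq_0[OF subspace_span], intro ballI impI)
    fix v assume v: "v \<in> span U" "L v = 0"
    have "\<phi> i v = 0" if "i \<in> X" for i
      using lookup_L[of v i] v(2) that by simp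
    with v(1) show "v = 0"
      by (rule sep)
  qed
  then have "pm.independent (L ` U)" "card (L ` U) = card U"
    using L.independent_injective_image[OF assms(2)] span_superset[of U]
    by (auto intro!: card_image intro: inj_on_subset)
  moreover have "L ` U \<subseteq> pm.span ((\<lambda>i. Poly_Mapping.single i 1) ` X)"
    using assms(1) by (auto intro!: pm_in_span_singles simp: in_keys_iff lookup_L split: if_splits)
  ultimately have "card U \<le> card ((\<lambda>i. Poly_Mapping.single i (1::'a)) ` X)"
    using pm.independent_span_bound[of "(\<lambda>i. Poly_Mapping.single i (1::'a)) ` X" "L ` U"] assms(1) by simp
  also have "\<dots> \<le> card X"
    using assms(1) by (rule card_image_le)
  finally show ?thesis .
qed

lemma pm_push_eq_linear_extension: "pm_push h = linear_extension pm_scale (\<lambda>k. Poly_Mapping.single (h k) 1)"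
  by (intro ext) (simp add: pm_push_def linear_extension_def flip: single_eq_pm_scale)

lemma linear_pm_push: "Vector_Spaces.linear pm_scale pm_scale (pm_push h)"
  unfolding pm_push_eq_linear_extension by (rule pm.linear_linear_extension)

lemma pm_push_single: "pm_push h (Poly_Mapping.single k c) = Poly_Mapping.single (h k) c"
  by (cases "c = 0") (simp_all add: pm_push_def)

lemma pm_push_sum: "pm_push h (\<Sum>i\<in>I. f i) = (\<Sum>i\<in>I. pm_push h (f i))"
proof -
  interpret Vector_Spaces.linear pm_scale pm_scale "pm_push h" by (rule linear_pm_push)
  show ?thesis by (rule sum)
qed

lemma pm_push_comp: "pm_push h (pm_push h' p) = pm_push (h \<circ> h') p"
proof -
  have "(pm_push h \<circ> pm_push h') p = pm_push (h \<circ> h') p"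
    by (rule pm.pm_linear_eqI[OF Vector_Spaces.linear_compose[OF linear_pm_push linear_pm_push] linear_pm_push])
       (simp add: pm_push_single)
  then show ?thesis by simp
qed

lemma keys_pm_push: "Poly_Mapping.keys (pm_push h p) \<subseteq> h ` Poly_Mapping.keys p"
proof -
  have "Poly_Mapping.keys (pm_push h p)
      \<subseteq> (\<Union>k\<in>Poly_Mapping.keys p. Poly_Mapping.keys (Poly_Mapping.single (h k) (Poly_Mapping.lookup p k)))"
    unfolding pm_push_def by (rule keys_sum)
  then show ?thesis
    by auto
qed


section \<open>Averaging over a group with a sign\<close>

text \<open>
  Left cancellation in the finite set \<open>G\<close> makes every left multiplication a permutation of \<open>G\<close>;
  reindexing along it is what turns the average into a vector on which \<open>G\<close> acts by the sign \<open>\<epsilon>\<close>.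
  The product is a parameter because the two groups below multiply differently: permutations are
  composed, and tuples of permutations are composed componentwise.
\<close>

locale signed_action =
  fixes G :: "'s set" and m :: "'s \<Rightarrow> 's \<Rightarrow> 's" and \<epsilon> :: "'s \<Rightarrow> 'f::field_char_0"
    and T :: "'s \<Rightarrow> ('k \<Rightarrow>\<^sub>0 'f) \<Rightarrow> ('k \<Rightarrow>\<^sub>0 'f)"
  assumes finite_G: "finite G" and nonempty: "G \<noteq> {}"
    and closed: "\<tau> \<in> G \<Longrightarrow> \<sigma> \<in> G \<Longrightarrow> m \<tau> \<sigma> \<in> G"
    and inj: "\<tau> \<in> G \<Longrightarrow> inj_on (m \<tau>) G"
    and sign_mult: "\<tau> \<in> G \<Longrightarrow> \<sigma> \<in> G \<Longrightarrow> \<epsilon> (m \<tau> \<sigma>) = \<epsilon> \<tau> * \<epsilon> \<sigma>"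
    and sign_square: "\<tau> \<in> G \<Longrightarrow> \<epsilon> \<tau> * \<epsilon> \<tau> = 1"
    and linear_T: "\<tau> \<in> G \<Longrightarrow> Vector_Spaces.linear pm_scale pm_scale (T \<tau>)"
    and T_mult: "\<tau> \<in> G \<Longrightarrow> \<sigma> \<in> G \<Longrightarrow> T (m \<tau> \<sigma>) v = T \<tau> (T \<sigma> v)"
begin

definition average :: "('k \<Rightarrow>\<^sub>0 'f) \<Rightarrow> ('k \<Rightarrow>\<^sub>0 'f)" where
  "average v = (\<Sum>\<sigma>\<in>G. pm_scale (\<epsilon> \<sigma> / of_nat (card G)) (T \<sigma> v))"

lemma linear_average: "Vector_Spaces.linear pm_scale pm_scale average"
proof -
  interpret vector_space_pair "pm_scale :: 'f \<Rightarrow> ('k \<Rightarrow>\<^sub>0 'f) \<Rightarrow> _" "pm_scale :: 'f \<Rightarrow> ('k \<Rightarrow>\<^sub>0 'f) \<Rightarrow> _" ..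
  have "Vector_Spaces.linear pm_scale pm_scale (\<lambda>v. \<Sum>\<sigma>\<in>G. pm_scale (\<epsilon> \<sigma> / of_nat (card G)) (T \<sigma> v))"
    by (intro linear_compose_sum ballI linear_compose_scale_right linear_T)
  then show ?thesis
    by (simp add: average_def[abs_def])
qed

lemma T_average:
  assumes "\<tau> \<in> G"
  shows "T \<tau> (average v) = pm_scale (\<epsilon> \<tau>) (average v)"
proof -
  interpret T: Vector_Spaces.linear pm_scale pm_scale "T \<tau>"
    by (rule linear_T[OF assms])
  let ?c = "\<lambda>\<sigma>. pm_scale (\<epsilon> \<tau> * \<epsilon> \<sigma> / of_nat (card G)) (T \<sigma> v)"
  have sgn: "\<epsilon> \<sigma> = \<epsilon> \<tau> * \<epsilon> (m \<tau> \<sigma>)" if "\<sigma> \<in> G" for \<sigma>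
    using sign_square[OF assms] by (simp add: sign_mult[OF assms that] flip: mult.assoc)
  have "T \<tau> (average v) = (\<Sum>\<sigma>\<in>G. pm_scale (\<epsilon> \<sigma> / of_nat (card G)) (T (m \<tau> \<sigma>) v))"
    by (simp add: average_def T.sum T.scale T_mult assms)
  also have "\<dots> = (\<Sum>\<sigma>\<in>G. ?c (m \<tau> \<sigma>))"
    by (intro sum.cong refl) (simp flip: sgn)
  also have "\<dots> = (\<Sum>\<sigma>\<in>m \<tau> ` G. ?c \<sigma>)"
    by (simp add: sum.reindex[OF inj[OF assms]])
  also have "m \<tau> ` G = G"
    using closed[OF assms] by (intro card_subset_eq finite_G) (auto simp: card_image inj assms)
  also have "(\<Sum>\<sigma>\<in>G. ?c \<sigma>) = pm_scale (\<epsilon> \<tau>) (average v)"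
    by (simp add: average_def pm.scale_sum_right)
  finally show ?thesis .
qed

lemma average_idempotent: "average (average v) = average v"
proof -
  have "average (average v) = (\<Sum>\<sigma>\<in>G. pm_scale (\<epsilon> \<sigma> * \<epsilon> \<sigma> / of_nat (card G)) (average v))"
    by (subst (1) average_def) (simp add: T_average)
  also have "\<dots> = (\<Sum>\<sigma>\<in>G. pm_scale (1 / of_nat (card G)) (average v))"
    by (intro sum.cong refl) (simp add: sign_square)
  also have "\<dots> = average v"
    using finite_G nonempty by (simp add: pm.sum_constant_scale)
  finally show ?thesis .
qed

text \<open>
  Since the trace is linear, pairing the character of \<open>V / W\<close> with \<open>\<epsilon>\<close> gives the trace of the
  idempotent \<open>average\<close>.  It is therefore a natural number, namely the dimension of the space of
  vectors of \<open>V / W\<close> on which \<open>G\<close> acts by \<open>\<epsilon>\<close>.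
\<close>

lemma signed_trace:
  assumes VW: "pm.subspace V" "pm.subspace W" "W \<subseteq> V" "finite S" "V \<subseteq> pm.span S"
    and inv: "\<forall>\<tau>\<in>G. T \<tau> ` V \<subseteq> V" "\<forall>\<tau>\<in>G. T \<tau> ` W \<subseteq> W"
  obtains U where "finite U" "U \<subseteq> average ` V" "pm.independent U" "pm.span U \<inter> W = {0}"
    "average ` V \<subseteq> pm.span (U \<union> W)"
    "(\<Sum>\<sigma>\<in>G. \<epsilon> \<sigma> / of_nat (card G) * pm.quotient_trace V W (T \<sigma>)) = of_nat (card U)"
proof -
  have stable: "average ` V \<subseteq> V" "average ` W \<subseteq> W"
    using inv VW(1,2) by (auto simp: average_def image_subset_iff intro!: pm.subspace_sum pm.subspace_scale)
  obtain U where U: "finite U" "U \<subseteq> average ` V" "pm.independent U" "pm.span U \<inter> W = {0}"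
    "average ` V \<subseteq> pm.span (U \<union> W)" "pm.quotient_trace V W average = of_nat (card U)"
    by (rule pm.quotient_trace_idempotent[OF VW linear_average stable]) (rule average_idempotent, rule that)
  moreover have "pm.quotient_trace V W average
      = (\<Sum>\<sigma>\<in>G. \<epsilon> \<sigma> / of_nat (card G) * pm.quotient_trace V W (T \<sigma>))"
    unfolding average_def[abs_def]
    using inv(1) by (intro pm.quotient_trace_linear_combination[OF VW]) auto
  ultimately show ?thesis
    by (intro that) auto
qed

end


section \<open>Row and column stabilizers\<close>

lemma finite_sym_group: "finite (sym_group n)"
  by (simp add: sym_group_def finite_permutations)

lemma sym_group_lt: "p \<in> sym_group n \<Longrightarrow> m < n \<Longrightarrow> p m < n"
  using permutes_in_image[of p "{..<n}" m] by (simp add: sym_group_def)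

lemma box_inj:
  "m < sum_list \<mu> \<Longrightarrow> m' < sum_list \<mu> \<Longrightarrow> box \<mu> m = box \<mu> m' \<Longrightarrow> m = m'"
proof (induction \<mu> arbitrary: m m')
  case (Cons l ls)
  show ?case
  proof (cases "m < l \<or> m' < l")
    case True
    then show ?thesis
      using Cons.prems(3) by (auto split: if_splits simp: prod_eq_iff)
  next
    case False
    then have "box ls (m - l) = box ls (m' - l)"
      using Cons.prems(3) by (simp add: prod_eq_iff)
    then have "m - l = m' - l"
      using Cons.prems(1,2) False by (intro Cons.IH) auto
    then show ?thesis
      using False by auto
  qed
qed simp

lemma box_row_lt: "m < sum_list \<mu> \<Longrightarrow> fst (box \<mu> m) < length \<mu>"
  by (induction \<mu> arbitrary: m) auto

text \<open>
  In a partition the parts are positive, so every row starts with an actual entry.  This supplies as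
  many entries in the first column as there are rows.
\<close>

lemma box_first_column:
  "0 \<notin> set \<mu> \<Longrightarrow> i < length \<mu> \<Longrightarrow> \<exists>m < sum_list \<mu>. box \<mu> m = (i, 0)"
proof (induction \<mu> arbitrary: i)
  case (Cons l ls)
  show ?case
  proof (cases i)
    case 0
    then show ?thesis
      using Cons.prems(1) by (intro exI[of _ 0]) auto
  next
    case (Suc i')
    then obtain m where "m < sum_list ls" "box ls m = (i', 0)"
      using Cons.IH[of i'] Cons.prems by auto
    then show ?thesis
      using Suc by (intro exI[of _ "l + m"]) auto
  qed
qed simp

text \<open>A subgroup of a symmetric group together with a character of it with values \<open>\<plusminus>1\<close>.\<close>

locale sym_signed_subgroup =
  fixes n :: nat and G :: "(nat \<Rightarrow> nat) set" and \<epsilon> :: "(nat \<Rightarrow> nat) \<Rightarrow> 'f::field_char_0"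
  assumes sub: "G \<subseteq> sym_group n"
    and id_in: "id \<in> G"
    and comp_in: "\<sigma> \<in> G \<Longrightarrow> \<tau> \<in> G \<Longrightarrow> \<sigma> \<circ> \<tau> \<in> G"
    and eps_mult: "\<sigma> \<in> G \<Longrightarrow> \<tau> \<in> G \<Longrightarrow> \<epsilon> (\<sigma> \<circ> \<tau>) = \<epsilon> \<sigma> * \<epsilon> \<tau>"
    and eps_square: "\<sigma> \<in> G \<Longrightarrow> \<epsilon> \<sigma> * \<epsilon> \<sigma> = 1"
begin

lemma finite_subgroup: "finite G"
  using sub finite_sym_group finite_subset by blast

lemma comp_cancel: "\<tau> \<in> G \<Longrightarrow> \<tau> \<circ> \<sigma> = \<tau> \<circ> \<sigma>' \<Longrightarrow> \<sigma> = \<sigma>'"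
  using sub permutes_inj[of \<tau> "{..<n}"] by (auto simp: sym_group_def fun_eq_iff inj_eq)

end

lemma row_stabilizer_signed:
  "sym_signed_subgroup (sum_list \<mu>) (row_stabilizer \<mu>) (\<lambda>_. 1)"
  by unfold_locales
     (auto simp: row_stabilizer_def sym_group_lt, auto simp: sym_group_def permutes_id permutes_compose)

lemma column_stabilizer_signed:
  "sym_signed_subgroup (sum_list \<mu>) (column_stabilizer \<mu>) (\<lambda>\<tau>. of_int (sign \<tau>))"
proof -
  have "sign (\<sigma> \<circ> \<tau>) = sign \<sigma> * sign \<tau>"
    if "\<sigma> \<in> column_stabilizer \<mu>" "\<tau> \<in> column_stabilizer \<mu>" for \<sigma> \<tau>
    using that
    by (intro sign_compose permutes_imp_permutation[of "{..<sum_list \<mu>}"])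
       (auto simp: column_stabilizer_def sym_group_def)
  moreover have "sign \<sigma> * sign \<sigma> = 1" for \<sigma> :: "nat \<Rightarrow> nat"
    by (simp add: sign_idempotent)
  ultimately show ?thesis
    by unfold_locales
       (auto simp flip: of_int_mult,
        auto simp: column_stabilizer_def sym_group_lt,
        auto simp: sym_group_def permutes_id permutes_compose)
qed


section \<open>Fixed vectors in the Young modules\<close>

lemma (in vector_space) linear_extension_image:
  assumes "finite S"
  shows "linear_extension scale f ` {p. Poly_Mapping.keys p \<subseteq> S} = span (f ` S)"
proof (rule antisym)
  show "linear_extension scale f ` {p. Poly_Mapping.keys p \<subseteq> S} \<subseteq> span (f ` S)"
    by (auto simp: linear_extension_def intro!: span_sum span_scale intro: span_base)
  interpret L: Vector_Spaces.linear pm_scale scale "linear_extension scale f"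
    by (rule linear_linear_extension)
  have "f k \<in> linear_extension scale f ` {p. Poly_Mapping.keys p \<subseteq> S}" if "k \<in> S" for k
    using that by (intro image_eqI[of _ _ "Poly_Mapping.single k 1"]) (simp_all add: linear_extension_single)
  then show "span (f ` S) \<subseteq> linear_extension scale f ` {p. Poly_Mapping.keys p \<subseteq> S}"
    by (intro span_minimal L.subspace_image pm_subspace_keys) auto
qed

abbreviation left_mult :: "(nat \<Rightarrow> nat) \<Rightarrow> ((nat \<Rightarrow> nat) \<Rightarrow>\<^sub>0 'f::field) \<Rightarrow> ((nat \<Rightarrow> nat) \<Rightarrow>\<^sub>0 'f)" where
  "left_mult \<sigma> \<equiv> pm_push (\<lambda>p. \<sigma> \<circ> p)"

lemma left_mult_comp: "left_mult (\<sigma> \<circ> \<tau>) v = left_mult \<sigma> (left_mult \<tau> v)"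
  by (simp add: pm_push_comp comp_def)

lemma conv_eq_linear_extension: "conv x y = linear_extension pm_scale (\<lambda>p. left_mult p y) x"
proof -
  have "(\<Sum>q\<in>Poly_Mapping.keys y. Poly_Mapping.single (p \<circ> q) (c * Poly_Mapping.lookup y q))
      = pm_scale c (left_mult p y)" for p c
    unfolding pm_push_def pm.scale_sum_right
    by (intro sum.cong refl poly_mapping_eqI) (simp add: lookup_single when_def)
  then show ?thesis
    by (simp add: conv_def linear_extension_def)
qed

text \<open>
  As a span, the Young module is visibly a finite dimensional subspace stable under the group, which
  the trace formula requires.
\<close>

lemma young_module_eq_span:
  "young_module \<mu> = pm.span ((\<lambda>p. left_mult p (young_symmetrizer \<mu>)) ` sym_group (sum_list \<mu>))"
  unfolding pm.linear_extension_image[OF finite_sym_group, symmetric]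
  by (auto simp: young_module_def conv_eq_linear_extension)

lemma left_mult_young_module:
  assumes "\<sigma> \<in> sym_group (sum_list \<mu>)" "v \<in> young_module \<mu>"
  shows "left_mult \<sigma> v \<in> young_module \<mu>"
proof -
  let ?y = "young_symmetrizer \<mu>" and ?S = "sym_group (sum_list \<mu>)"
  interpret L: Vector_Spaces.linear pm_scale pm_scale "left_mult \<sigma>"
    by (rule linear_pm_push)
  have "left_mult \<sigma> v \<in> left_mult \<sigma> ` pm.span ((\<lambda>p. left_mult p ?y) ` ?S)"
    using assms(2) by (simp add: young_module_eq_span)
  also have "\<dots> = pm.span ((\<lambda>p. left_mult (\<sigma> \<circ> p) ?y) ` ?S)"
    unfolding L.span_image[symmetric] by (simp add: image_image left_mult_comp)
  also have "\<dots> \<subseteq> young_module \<mu>"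
    unfolding young_module_eq_span
    using assms(1) by (intro pm.span_mono) (auto simp: sym_group_def permutes_compose)
  finally show ?thesis .
qed

lemma young_symmetrizer_in_young_module: "young_symmetrizer \<mu> \<in> young_module \<mu>"
proof -
  have "left_mult id (young_symmetrizer \<mu>) = young_symmetrizer \<mu>"
    by (simp add: young_symmetrizer_def pm_push_sum pm_push_single)
  moreover have "id \<in> sym_group (sum_list \<mu>)"
    by (simp add: sym_group_def permutes_id)
  ultimately show ?thesis
    unfolding young_module_eq_span by (metis (mono_tags, lifting) image_eqI pm.span_base)
qed

context sym_signed_subgroup
begin

sublocale left: signed_action G "(\<circ>)" \<epsilon> left_mult
proof (rule signed_action.intro)
  show "inj_on ((\<circ>) \<tau>) G" if "\<tau> \<in> G" for \<tau>
    using comp_cancel[OF that] by (rule inj_onI)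
next
  show "Vector_Spaces.linear pm_scale pm_scale (left_mult \<tau>)" for \<tau> :: "nat \<Rightarrow> nat"
    by (rule linear_pm_push)
qed (use id_in in \<open>auto simp: finite_subgroup comp_in eps_mult eps_square left_mult_comp\<close>)

text \<open>
  The number \<open>r\<close> is the dimension of the space of vectors of the Young module on which \<open>G\<close> acts by
  \<open>\<epsilon>\<close>.  For general \<open>\<mu>\<close> it matters only that it is a natural number, so that nothing can cancel
  in a sum over all partitions.
\<close>

lemma young_module_trace:
  assumes n: "n = sum_list \<mu>"
  obtains r where "(\<Sum>\<sigma>\<in>G. \<epsilon> \<sigma> / of_nat (card G) * irr_char \<mu> \<sigma>) = of_nat r"
    "left.average (young_symmetrizer \<mu>) \<noteq> 0 \<Longrightarrow> r \<ge> 1"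
proof -
  let ?V = "young_module \<mu> :: ((nat \<Rightarrow> nat) \<Rightarrow>\<^sub>0 'f) set"
  have V: "pm.subspace ?V" "pm.subspace {0 :: (nat \<Rightarrow> nat) \<Rightarrow>\<^sub>0 'f}" "{0} \<subseteq> ?V"
    "finite ((\<lambda>p. left_mult p (young_symmetrizer \<mu> :: (nat \<Rightarrow> nat) \<Rightarrow>\<^sub>0 'f)) ` sym_group (sum_list \<mu>))"
    "?V \<subseteq> pm.span ((\<lambda>p. left_mult p (young_symmetrizer \<mu>)) ` sym_group (sum_list \<mu>))"
    by (auto simp: young_module_eq_span pm.span_zero finite_sym_group)
  have inv: "\<forall>\<tau>\<in>G. left_mult \<tau> ` ?V \<subseteq> ?V"
    using sub n by (auto intro!: left_mult_young_module)
  have inv0: "\<forall>\<tau>\<in>G. left_mult \<tau> ` {0 :: (nat \<Rightarrow> nat) \<Rightarrow>\<^sub>0 'f} \<subseteq> {0}"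
    by (simp add: pm_push_def)
  obtain U where U: "finite U" "U \<subseteq> left.average ` ?V" "pm.independent U" "pm.span U \<inter> {0} = {0}"
    "left.average ` ?V \<subseteq> pm.span (U \<union> {0})"
    "(\<Sum>\<sigma>\<in>G. \<epsilon> \<sigma> / of_nat (card G) * pm.quotient_trace ?V {0} (left_mult \<sigma>)) = of_nat (card U)"
    by (rule left.signed_trace[OF V inv inv0]) (rule that)
  have "card U \<ge> 1" if "left.average (young_symmetrizer \<mu>) \<noteq> 0"
  proof (rule ccontr)
    assume "\<not> card U \<ge> 1"
    then have "U = {}"
      using U(1) by (simp add: not_le)
    then have "left.average ` ?V \<subseteq> {0}"
      using U(5) by simp
    then show False
      using that young_symmetrizer_in_young_module by blast
  qed
  moreover have "(\<Sum>\<sigma>\<in>G. \<epsilon> \<sigma> / of_nat (card G) * irr_char \<mu> \<sigma>) = of_nat (card U)"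
    using U(6) by (simp add: irr_char_def)
  ultimately show ?thesis
    using that by blast
qed

text \<open>
  The coefficient of the identity in the averaged Young symmetrizer is a sum over the triples
  \<open>(\<tau>, \<rho>, \<gamma>)\<close> with \<open>\<tau> \<rho> \<gamma> = 1\<close>. The hypothesis makes all its terms equal and positive, and
  the triple of identities contributes one.
\<close>

lemma average_young_symmetrizer_nonzero:
  assumes "\<And>\<tau> \<rho> \<gamma>. \<tau> \<in> G \<Longrightarrow> \<rho> \<in> row_stabilizer \<mu> \<Longrightarrow> \<gamma> \<in> column_stabilizer \<mu> \<Longrightarrow>
      \<tau> \<circ> (\<rho> \<circ> \<gamma>) = id \<Longrightarrow> \<epsilon> \<tau> * of_int (sign \<gamma>) = 1"
  shows "left.average (young_symmetrizer \<mu>) \<noteq> 0"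
proof -
  let ?R = "row_stabilizer \<mu>" and ?C = "column_stabilizer \<mu>"
  interpret R: sym_signed_subgroup "sum_list \<mu>" ?R "\<lambda>_. 1 :: 'f"
    by (rule row_stabilizer_signed)
  interpret C: sym_signed_subgroup "sum_list \<mu>" ?C "\<lambda>\<tau>. of_int (sign \<tau>) :: 'f"
    by (rule column_stabilizer_signed)
  define X where "X = {(\<tau>, \<rho>, \<gamma>) \<in> G \<times> ?R \<times> ?C. \<tau> \<circ> (\<rho> \<circ> \<gamma>) = id}"
  have fin: "finite (G \<times> ?R \<times> ?C)"
    using finite_subgroup R.finite_subgroup C.finite_subgroup by simp
  have "Poly_Mapping.lookup (left.average (young_symmetrizer \<mu>)) id
      = (\<Sum>\<tau>\<in>G. \<Sum>\<rho>\<in>?R. \<Sum>\<gamma>\<in>?C. \<epsilon> \<tau> / of_nat (card G) * (of_int (sign \<gamma>) when \<tau> \<circ> (\<rho> \<circ> \<gamma>) = id))"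
    by (simp add: left.average_def young_symmetrizer_def pm_push_sum pm_push_single lookup_sum
        lookup_single sum_distrib_left)
  also have "\<dots> = (\<Sum>(\<tau>, \<rho>, \<gamma>)\<in>G \<times> ?R \<times> ?C.
      \<epsilon> \<tau> / of_nat (card G) * (of_int (sign \<gamma>) when \<tau> \<circ> (\<rho> \<circ> \<gamma>) = id))"
    by (simp add: sum.cartesian_product)
  also have "\<dots> = (\<Sum>x\<in>X. 1 / of_nat (card G))"
    using fin by (intro sum.mono_neutral_cong_right) (auto simp: X_def assms split: prod.splits)
  also have "\<dots> = of_nat (card X) / of_nat (card G)"
    by simp
  also have "\<dots> \<noteq> 0"
  proof -
    have "finite X"
      using fin by (rule rev_finite_subset) (auto simp: X_def)
    moreover have "(id, id, id) \<in> X"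
      using id_in R.id_in C.id_in by (simp add: X_def)
    ultimately have "card X \<noteq> 0"
      by auto
    then show ?thesis
      using finite_subgroup id_in by auto
  qed
  finally show ?thesis
    by (metis lookup_zero)
qed

end

lemma row_column_stabilizer_fix:
  assumes "fst (box \<mu> m) = fst (box \<mu> m')" "snd (box \<mu> m) = snd (box \<mu> m')"
    and "m < sum_list \<mu>" "m' < sum_list \<mu>"
  shows "m = m'"
  using assms by (intro box_inj) (auto simp: prod_eq_iff)

text \<open>
  If \<open>\<tau> \<rho> \<gamma> = 1\<close> with \<open>\<tau>\<close>, \<open>\<rho>\<close> preserving rows, then \<open>\<gamma>\<close> preserves rows as well as columns
  and is the identity.
\<close>

lemma row_average_young_symmetrizer_nonzero:
  "signed_action.average (row_stabilizer \<mu>) (\<lambda>_. 1 :: 'f::field_char_0) left_mult (young_symmetrizer \<mu>) \<noteq> 0"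
proof -
  interpret R: sym_signed_subgroup "sum_list \<mu>" "row_stabilizer \<mu>" "\<lambda>_. 1 :: 'f"
    by (rule row_stabilizer_signed)
  show ?thesis
  proof (rule R.average_young_symmetrizer_nonzero)
    fix \<tau> \<rho> \<gamma> :: "nat \<Rightarrow> nat"
    assume *: "\<tau> \<in> row_stabilizer \<mu>" "\<rho> \<in> row_stabilizer \<mu>" "\<gamma> \<in> column_stabilizer \<mu>" "\<tau> \<circ> (\<rho> \<circ> \<gamma>) = id"
    have "\<gamma> m = m" for m
    proof (cases "m < sum_list \<mu>")
      case True
      have lt: "\<gamma> m < sum_list \<mu>" "\<rho> (\<gamma> m) < sum_list \<mu>"
        using * True by (auto simp: row_stabilizer_def column_stabilizer_def sym_group_lt)
      have "fst (box \<mu> (\<gamma> m)) = fst (box \<mu> (\<tau> (\<rho> (\<gamma> m))))"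
        using *(1,2) lt by (simp add: row_stabilizer_def)
      also have "\<tau> (\<rho> (\<gamma> m)) = m"
        using *(4) by (simp add: fun_eq_iff)
      finally have "fst (box \<mu> (\<gamma> m)) = fst (box \<mu> m)" .
      moreover have "snd (box \<mu> (\<gamma> m)) = snd (box \<mu> m)"
        using *(3) True by (simp add: column_stabilizer_def)
      ultimately show ?thesis
        using True lt(1) by (metis row_column_stabilizer_fix)
    next
      case False
      then show ?thesis
        using *(3) by (auto simp: column_stabilizer_def sym_group_def permutes_def)
    qed
    then have "\<gamma> = id"
      by auto
    then show "1 * of_int (sign \<gamma>) = (1::'f)"
      by simp
  qed
qed

text \<open>
  If \<open>\<tau> \<rho> \<gamma> = 1\<close> with \<open>\<tau>\<close>, \<open>\<gamma>\<close> preserving columns, then so does \<open>\<rho>\<close>, which is therefore the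
  identity; hence \<open>\<tau>\<close> and \<open>\<gamma>\<close> are inverse to each other and have the same sign.
\<close>

lemma column_average_young_symmetrizer_nonzero:
  "signed_action.average (column_stabilizer \<mu>) (\<lambda>\<tau>. of_int (sign \<tau>) :: 'f::field_char_0) left_mult
     (young_symmetrizer \<mu>) \<noteq> 0"
proof -
  interpret C: sym_signed_subgroup "sum_list \<mu>" "column_stabilizer \<mu>" "\<lambda>\<tau>. of_int (sign \<tau>) :: 'f"
    by (rule column_stabilizer_signed)
  show ?thesis
  proof (rule C.average_young_symmetrizer_nonzero)
    fix \<tau> \<rho> \<gamma> :: "nat \<Rightarrow> nat"
    assume *: "\<tau> \<in> column_stabilizer \<mu>" "\<rho> \<in> row_stabilizer \<mu>" "\<gamma> \<in> column_stabilizer \<mu>" "\<tau> \<circ> (\<rho> \<circ> \<gamma>) = id"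
    have "\<rho> (\<gamma> m) = \<gamma> m" if "m < sum_list \<mu>" for m
    proof -
      have lt: "\<gamma> m < sum_list \<mu>" "\<rho> (\<gamma> m) < sum_list \<mu>"
        using * that by (auto simp: row_stabilizer_def column_stabilizer_def sym_group_lt)
      have "snd (box \<mu> (\<rho> (\<gamma> m))) = snd (box \<mu> (\<tau> (\<rho> (\<gamma> m))))"
        using *(1) lt by (simp add: column_stabilizer_def)
      also have "\<tau> (\<rho> (\<gamma> m)) = m"
        using *(4) by (simp add: fun_eq_iff)
      also have "snd (box \<mu> m) = snd (box \<mu> (\<gamma> m))"
        using *(3) that by (simp add: column_stabilizer_def)
      finally have "snd (box \<mu> (\<rho> (\<gamma> m))) = snd (box \<mu> (\<gamma> m))" .
      moreover have "fst (box \<mu> (\<rho> (\<gamma> m))) = fst (box \<mu> (\<gamma> m))"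
        using *(2) lt(1) by (simp add: row_stabilizer_def)
      ultimately show ?thesis
        using lt by (metis row_column_stabilizer_fix)
    qed
    moreover have "\<rho> (\<gamma> m) = \<gamma> m" if "\<not> m < sum_list \<mu>" for m
      using that *(2,3) by (auto simp: column_stabilizer_def row_stabilizer_def sym_group_def permutes_def)
    ultimately have "\<rho> \<circ> \<gamma> = \<gamma>"
      unfolding fun_eq_iff comp_apply by blast
    with *(4) have "\<tau> \<circ> \<gamma> = id"
      by (simp only:)
    then have "of_int (sign (id :: nat \<Rightarrow> nat)) = of_int (sign \<tau>) * (of_int (sign \<gamma>) :: 'f)"
      using C.eps_mult[OF *(1,3)] by (simp only:)
    then show "of_int (sign \<tau>) * of_int (sign \<gamma>) = (1::'f)"
      by simp
  qed
qed


section \<open>Multilinear polynomials and their evaluations\<close>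

lemma leaves_map_mono: "leaves (map_mono r t) = map r (leaves t)"
  by (induction t) auto

lemma eval_mono_map_mono: "eval_mono amul a (map_mono r t) = eval_mono amul (a \<circ> r) t"
  by (induction t) auto

lemma eval_mono_cong:
  "(\<And>x. x \<in> set (leaves t) \<Longrightarrow> a x = a' x) \<Longrightarrow> eval_mono amul a t = eval_mono amul a' t"
  by (induction t) auto

text \<open>
  The two factors of a product have fewer leaves than the product, because every monomial has at
  least one leaf.
\<close>

lemma finite_monos_bounded_leaves:
  assumes "finite V"
  shows "finite {t. length (leaves t) \<le> n \<and> set (leaves t) \<subseteq> V}"
proof (induction n)
  case 0
  have "leaves t \<noteq> []" for t :: "'a mono"
    by (induction t) auto
  then show ?case
    by simp
next
  case (Suc n)
  let ?M = "{t. length (leaves t) \<le> n \<and> set (leaves t) \<subseteq> V}"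
  have pos: "length (leaves t) > 0" for t :: "'a mono"
    by (induction t) auto
  have "{t. length (leaves t) \<le> Suc n \<and> set (leaves t) \<subseteq> V}
      \<subseteq> Var ` V \<union> (\<lambda>(s, t). Prod s t) ` (?M \<times> ?M)"
  proof
    fix t assume t: "t \<in> {t. length (leaves t) \<le> Suc n \<and> set (leaves t) \<subseteq> V}"
    show "t \<in> Var ` V \<union> (\<lambda>(s, t). Prod s t) ` (?M \<times> ?M)"
    proof (cases t)
      case (Prod u v)
      have "length (leaves u) + length (leaves v) \<le> Suc n" "set (leaves u) \<subseteq> V" "set (leaves v) \<subseteq> V"
        using t Prod by auto
      moreover from this have "length (leaves u) \<le> n" "length (leaves v) \<le> n"
        using pos[of u] pos[of v] by linarith+
      ultimately show ?thesis
        using Prod by (auto intro!: image_eqI[of _ _ "(u, v)"])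
    qed (use t in auto)
  qed
  then show ?case
    by (rule finite_subset) (simp add: Suc assms)
qed

definition multilinear_monos :: "'v set \<Rightarrow> 'v mono set" where
  "multilinear_monos V = {t. distinct (leaves t) \<and> set (leaves t) = V}"

lemma multilinear_polys_eq: "multilinear_polys V = {f. Poly_Mapping.keys f \<subseteq> multilinear_monos V}"
  by (auto simp: multilinear_polys_def multilinear_monos_def)

lemma finite_multilinear_monos:
  assumes "finite V"
  shows "finite (multilinear_monos V)"
proof (rule finite_subset[OF _ finite_monos_bounded_leaves[OF assms, of "card V"]])
  show "multilinear_monos V \<subseteq> {t. length (leaves t) \<le> card V \<and> set (leaves t) \<subseteq> V}"
    by (auto simp: multilinear_monos_def distinct_card)
qed

lemma pm_push_multilinear_polys:
  assumes "bij_betw r V V" "f \<in> multilinear_polys V"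
  shows "pm_push (map_mono r) f \<in> multilinear_polys V"
proof -
  have "map_mono r t \<in> multilinear_monos V" if "t \<in> multilinear_monos V" for t
    using that assms(1) by (auto simp: multilinear_monos_def leaves_map_mono distinct_map bij_betw_def)
  then show ?thesis
    using assms(2) keys_pm_push[of "map_mono r" f] by (fastforce simp: multilinear_polys_eq)
qed

context graded_algebra
begin

lemma eval_eq_linear_extension: "eval a = linear_extension scale (eval_mono amul a)"
  by (intro ext) (simp add: eval_def linear_extension_def)

lemma linear_eval: "Vector_Spaces.linear pm_scale scale (eval a)"
  unfolding eval_eq_linear_extension by (rule linear_linear_extension)

lemma eval_pm_push: "eval a (pm_push (map_mono r) f) = eval (a \<circ> r) f"
proof -
  have "(eval a \<circ> pm_push (map_mono r)) f = eval (a \<circ> r) f"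
    by (rule pm_linear_eqI[OF Vector_Spaces.linear_compose[OF linear_pm_push linear_eval] linear_eval])
       (simp add: pm_push_single eval_eq_linear_extension linear_extension_single eval_mono_map_mono)
  then show ?thesis
    by simp
qed

lemma eval_cong:
  assumes "f \<in> multilinear_polys V" "\<And>x. x \<in> V \<Longrightarrow> a x = a' x"
  shows "eval a f = eval a' f"
  unfolding eval_def
  by (intro sum.cong refl arg_cong[where f = "scale _"] eval_mono_cong)
     (use assms in \<open>auto simp: multilinear_polys_def\<close>)

lemma linear_eval_mono_update:
  "distinct (leaves t) \<Longrightarrow> x \<in> set (leaves t) \<Longrightarrow>
     Vector_Spaces.linear scale scale (\<lambda>y. eval_mono amul (a(x := y)) t)"
proof (induction t)
  case (Var v)
  then show ?case
    by (simp add: linear_ident)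
next
  case (Prod s t)
  show ?case
  proof (cases "x \<in> set (leaves s)")
    case True
    then have "eval_mono amul (a(x := y)) t = eval_mono amul a t" for y
      using Prod.prems by (intro eval_mono_cong) auto
    then have "(\<lambda>y. eval_mono amul (a(x := y)) (Prod s t))
        = (\<lambda>z. amul z (eval_mono amul a t)) \<circ> (\<lambda>y. eval_mono amul (a(x := y)) s)"
      by (simp only: eval_mono.simps comp_def)
    moreover have "Vector_Spaces.linear scale scale (\<lambda>y. eval_mono amul (a(x := y)) s)"
      using True Prod.prems by (intro Prod.IH(1)) auto
    ultimately show ?thesis
      by (simp only: Vector_Spaces.linear_compose[OF _ linear_amul_left])
  next
    case False
    then have "eval_mono amul (a(x := y)) s = eval_mono amul a s" for y
      by (intro eval_mono_cong) auto
    then have "(\<lambda>y. eval_mono amul (a(x := y)) (Prod s t))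
        = (\<lambda>z. amul (eval_mono amul a s) z) \<circ> (\<lambda>y. eval_mono amul (a(x := y)) t)"
      by (simp only: eval_mono.simps comp_def)
    moreover have "Vector_Spaces.linear scale scale (\<lambda>y. eval_mono amul (a(x := y)) t)"
      using False Prod.prems by (intro Prod.IH(2)) auto
    ultimately show ?thesis
      by (simp only: Vector_Spaces.linear_compose[OF _ linear_amul_right])
  qed
qed

lemma linear_eval_update:
  assumes "f \<in> multilinear_polys V" "x \<in> V"
  shows "Vector_Spaces.linear scale scale (\<lambda>y. eval (a(x := y)) f)"
proof -
  interpret vector_space_pair scale scale ..
  show ?thesis
    unfolding eval_def
    by (intro linear_compose_sum ballI linear_compose_scale_right linear_eval_mono_update)
       (use assms in \<open>auto simp: multilinear_polys_def\<close>)
qed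

text \<open>
  A multilinear polynomial is determined by its values on spanning sets.  The induction frees the
  variables in \<open>S\<close> one after the other, from \<open>b x\<close> to its span.
\<close>

lemma eval_zero_of_spanning:
  assumes f: "f \<in> multilinear_polys V" and "finite V"
    and zero: "\<And>a. (\<And>x. x \<in> V \<Longrightarrow> a x \<in> b x) \<Longrightarrow> eval a f = 0"
    and a: "\<And>x. x \<in> V \<Longrightarrow> a x \<in> span (b x)"
  shows "eval a f = 0"
proof -
  have "\<forall>a. (\<forall>x\<in>V - S. a x \<in> b x) \<and> (\<forall>x\<in>S. a x \<in> span (b x)) \<longrightarrow> eval a f = 0"
    if "finite S" "S \<subseteq> V" for S
    using that
  proof induction
    case empty
    then show ?case
      using zero by simp
  next
    case (insert x S)
    show ?case
    proof (intro allI impI)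
      fix a assume a: "(\<forall>z\<in>V - insert x S. a z \<in> b z) \<and> (\<forall>z\<in>insert x S. a z \<in> span (b z))"
      interpret L: Vector_Spaces.linear scale scale "\<lambda>y. eval (a(x := y)) f"
        using f insert.prems by (intro linear_eval_update) auto
      have base: "eval (a(x := y)) f = 0" if "y \<in> b x" for y
      proof -
        have "(\<forall>z\<in>V - S. (a(x := y)) z \<in> b z) \<and> (\<forall>z\<in>S. (a(x := y)) z \<in> span (b z))"
          using a that insert.hyps by auto
        then show ?thesis
          using insert by blast
      qed
      have "a x \<in> span (b x)"
        using a by simp
      from base this have "eval (a(x := a x)) f = 0"
        by (rule L.eq_0_on_span)
      then show "eval a f = 0"
        by simp
    qed
  qed
  from this[OF \<open>finite V\<close> subset_refl, THEN spec, THEN mp] show ?thesis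
    by this (simp add: a)
qed

lemma subspace_P_space: "pm.subspace (P_space ns)"
  unfolding P_space_def multilinear_polys_eq by (rule pm_subspace_keys)

lemma subspace_graded_identities: "pm.subspace graded_identities"
proof -
  have "pm.subspace {f. eval a f = 0}" for a :: "'b \<times> nat \<Rightarrow> 'a"
  proof -
    interpret Vector_Spaces.linear pm_scale scale "eval a"
      by (rule linear_eval)
    show ?thesis
      by (rule subspace_kernel)
  qed
  then show ?thesis
    by (auto simp: graded_identities_def pm.subspace_def)
qed

end


section \<open>Multiplicities bounded by dimensions of spaces of isotypic vectors\<close>

locale finite_graded_algebra = graded_algebra scale amul gop gr
  for scale :: "'f::field_char_0 \<Rightarrow> 'a::ab_group_add \<Rightarrow> 'a"
    and amul :: "'a \<Rightarrow> 'a \<Rightarrow> 'a"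
    and gop :: "'g \<Rightarrow> 'g \<Rightarrow> 'g"
    and gr :: "'g \<Rightarrow> 'a set" +
  assumes finite_dimensional: "\<exists>B. finite B \<and> span B = UNIV"
    and finite_supp: "finite supp"

text \<open>
  A subgroup of \<open>H_group ns\<close> that is a product of one subgroup for each component, with the product
  of their signs.  Because of the product form, pairing this sign with an irreducible character of
  \<open>H_group ns\<close> is done one component at a time.
\<close>

locale signed_subgroups = finite_graded_algebra scale amul gop gr
  for scale :: "'f::field_char_0 \<Rightarrow> 'a::ab_group_add \<Rightarrow> 'a"
    and amul :: "'a \<Rightarrow> 'a \<Rightarrow> 'a"
    and gop :: "'g \<Rightarrow> 'g \<Rightarrow> 'g"
    and gr :: "'g \<Rightarrow> 'a set" +
  fixes ns :: "'g \<Rightarrow> nat" and G :: "'g \<Rightarrow> (nat \<Rightarrow> nat) set" and \<epsilon> :: "'g \<Rightarrow> (nat \<Rightarrow> nat) \<Rightarrow> 'f"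
  assumes signed: "g \<in> supp \<Longrightarrow> sym_signed_subgroup (ns g) (G g) (\<epsilon> g)"
begin

lemma rename_comp: "rename (\<lambda>g\<in>supp. \<tau> g \<circ> \<sigma> g) = rename \<tau> \<circ> rename \<sigma>"
  by (auto simp: rename_def)

lemma map_mono_rename_comp:
  "map_mono (rename (\<lambda>g\<in>supp. \<tau> g \<circ> \<sigma> g)) = map_mono (rename \<tau>) \<circ> map_mono (rename \<sigma>)"
  by (simp add: rename_comp mono.map_comp fun_eq_iff)

sublocale H: signed_action "Pi\<^sub>E supp G" "\<lambda>\<tau> \<sigma>. \<lambda>g\<in>supp. \<tau> g \<circ> \<sigma> g"
  "\<lambda>\<sigma>. \<Prod>g\<in>supp. \<epsilon> g (\<sigma> g)" "\<lambda>\<sigma>. pm_push (map_mono (rename \<sigma>)) :: (('g \<times> nat) mono \<Rightarrow>\<^sub>0 'f) \<Rightarrow> _"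
proof (rule signed_action.intro)
  note fin = sym_signed_subgroup.finite_subgroup[OF signed]
  show "finite (Pi\<^sub>E supp G)"
    using finite_supp fin by (rule finite_PiE)
  show "Pi\<^sub>E supp G \<noteq> {}"
    using sym_signed_subgroup.id_in[OF signed] by (auto simp: PiE_eq_empty_iff)
  show "(\<lambda>g\<in>supp. \<tau> g \<circ> \<sigma> g) \<in> Pi\<^sub>E supp G" if "\<tau> \<in> Pi\<^sub>E supp G" "\<sigma> \<in> Pi\<^sub>E supp G" for \<tau> \<sigma>
  proof -
    have "\<tau> g \<circ> \<sigma> g \<in> G g" if g: "g \<in> supp" for g
      using sym_signed_subgroup.comp_in[OF signed[OF g] PiE_mem[OF \<open>\<tau> \<in> _\<close> g] PiE_mem[OF \<open>\<sigma> \<in> _\<close> g]] .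
    then show ?thesis
      by simp
  qed
  show "inj_on (\<lambda>\<sigma>. \<lambda>g\<in>supp. \<tau> g \<circ> \<sigma> g) (Pi\<^sub>E supp G)" if \<tau>: "\<tau> \<in> Pi\<^sub>E supp G" for \<tau>
  proof (rule inj_onI)
    fix \<sigma> \<sigma>' assume *: "\<sigma> \<in> Pi\<^sub>E supp G" "\<sigma>' \<in> Pi\<^sub>E supp G"
      "(\<lambda>g\<in>supp. \<tau> g \<circ> \<sigma> g) = (\<lambda>g\<in>supp. \<tau> g \<circ> \<sigma>' g)"
    show "\<sigma> = \<sigma>'"
    proof (rule PiE_ext[OF *(1,2)])
      fix g assume g: "g \<in> supp"
      then have "\<tau> g \<circ> \<sigma> g = \<tau> g \<circ> \<sigma>' g"
        using fun_cong[OF *(3), of g] by simp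
      then show "\<sigma> g = \<sigma>' g"
        by (rule sym_signed_subgroup.comp_cancel[OF signed[OF g] PiE_mem[OF \<tau> g]])
    qed
  qed
  show "(\<Prod>g\<in>supp. \<epsilon> g ((\<lambda>g\<in>supp. \<tau> g \<circ> \<sigma> g) g)) = (\<Prod>g\<in>supp. \<epsilon> g (\<tau> g)) * (\<Prod>g\<in>supp. \<epsilon> g (\<sigma> g))"
    if "\<tau> \<in> Pi\<^sub>E supp G" "\<sigma> \<in> Pi\<^sub>E supp G" for \<tau> \<sigma>
    unfolding prod.distrib[symmetric] using that
    by (intro prod.cong refl) (auto simp: sym_signed_subgroup.eps_mult[OF signed] PiE_iff)
  show "(\<Prod>g\<in>supp. \<epsilon> g (\<tau> g)) * (\<Prod>g\<in>supp. \<epsilon> g (\<tau> g)) = 1" if "\<tau> \<in> Pi\<^sub>E supp G" for \<tau>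
    unfolding prod.distrib[symmetric] using that
    by (intro prod.neutral ballI) (auto simp: sym_signed_subgroup.eps_square[OF signed] PiE_iff)
  show "Vector_Spaces.linear pm_scale pm_scale (pm_push (map_mono (rename \<tau>)))" for \<tau>
    by (rule linear_pm_push)
  show "pm_push (map_mono (rename (\<lambda>g\<in>supp. \<tau> g \<circ> \<sigma> g))) v
      = pm_push (map_mono (rename \<tau>)) (pm_push (map_mono (rename \<sigma>)) v)" for \<tau> \<sigma> v
    by (simp add: map_mono_rename_comp pm_push_comp)
qed

lemma subgroup_H_group: "\<sigma> \<in> Pi\<^sub>E supp G \<Longrightarrow> \<sigma> \<in> H_group ns"
  using sym_signed_subgroup.sub[OF signed] by (auto simp: H_group_def PiE_iff)

end

context graded_algebra
begin

lemma rename_P_space: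
  assumes "\<sigma> \<in> H_group ns" "f \<in> P_space ns"
  shows "pm_push (map_mono (rename \<sigma>)) f \<in> P_space ns"
proof -
  let ?V = "SIGMA g:supp. {..<ns g}"
  have perm: "\<sigma> g permutes {..<ns g}" if "g \<in> supp" for g
    using assms(1) that by (auto simp: H_group_def sym_group_def)
  have "rename \<sigma> ` ?V = ?V"
  proof -
    have "rename \<sigma> ` ?V = (SIGMA g:supp. \<sigma> g ` {..<ns g})"
      by (force simp: rename_def)
    also have "\<dots> = ?V"
      using permutes_image[OF perm] by (intro Sigma_cong) auto
    finally show ?thesis .
  qed
  moreover have "inj_on (rename \<sigma>) ?V"
  proof (rule inj_onI)
    fix x y assume "x \<in> ?V" "y \<in> ?V" "rename \<sigma> x = rename \<sigma> y"
    then show "x = y"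
      using injD[OF permutes_inj[OF perm, of "fst x"], of "snd x" "snd y"]
      by (cases x; cases y) (simp add: rename_def)
  qed
  ultimately show ?thesis
    using pm_push_multilinear_polys[of "rename \<sigma>" ?V f] assms(2) by (auto simp: P_space_def bij_betw_def)
qed

lemma rename_graded_identities:
  "f \<in> graded_identities \<Longrightarrow> pm_push (map_mono (rename \<sigma>)) f \<in> graded_identities"
  by (auto simp: graded_identities_def eval_pm_push rename_def)

end

lemma finite_partitions: "finite (partitions n)"
proof (rule finite_subset)
  have "length \<mu> \<le> sum_list \<mu>" if "0 \<notin> set \<mu>" for \<mu> :: "nat list"
    using that by (induction \<mu>) auto
  then show "partitions n \<subseteq> {\<mu>. set \<mu> \<subseteq> {..n} \<and> length \<mu> \<le> n}"
    using member_le_sum_list by (fastforce simp: partitions_def)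
  show "finite {\<mu>. set \<mu> \<subseteq> {..n} \<and> length \<mu> \<le> n}"
    by (rule finite_lists_length_le) simp
qed

context signed_subgroups
begin

lemma average_P_space: "f \<in> P_space ns \<Longrightarrow> H.average f \<in> P_space ns"
  unfolding H.average_def
  by (intro pm.subspace_sum pm.subspace_scale subspace_P_space rename_P_space subgroup_H_group)

lemma finite_multipartitions: "finite (multipartitions ns)"
  unfolding multipartitions_def by (intro finite_PiE finite_supp finite_partitions)

text \<open>
  Pair both sides of the decomposition of the character of \<open>P_space ns / graded_identities\<close> with the
  product of the signs \<open>\<epsilon> g\<close> on the product of the groups \<open>G g\<close>.  The left hand side becomes the
  dimension of the space of vectors on which this group acts by its sign, and \<open>U\<close> represents a basis
  of that space.  On the right hand side the pairing factors over the components, so every \<open>m M\<close> is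
  multiplied by a product of natural numbers, and for \<open>M = \<Lambda>\<close> this product is positive.
\<close>

lemma multiplicity_le_card:
  assumes m: "are_multiplicities ns m" and \<Lambda>: "\<Lambda> \<in> multipartitions ns"
    and nonzero: "\<And>g. g \<in> supp \<Longrightarrow>
      signed_action.average (G g) (\<epsilon> g) left_mult (young_symmetrizer (\<Lambda> g)) \<noteq> 0"
  obtains U where "finite U" "U \<subseteq> H.average ` P_space ns" "pm.independent U"
    "pm.span U \<inter> (P_space ns \<inter> graded_identities) = {0}" "m \<Lambda> \<le> card U"
proof -
  let ?V = "P_space ns :: (('g \<times> nat) mono \<Rightarrow>\<^sub>0 'f) set" and ?G = "Pi\<^sub>E supp G"
  define W where "W = ?V \<inter> graded_identities"
  have V: "pm.subspace ?V" "pm.subspace W" "W \<subseteq> ?V"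
    "finite ((\<lambda>k. Poly_Mapping.single k (1::'f)) ` multilinear_monos (SIGMA g:supp. {..<ns g}))"
    "?V \<subseteq> pm.span ((\<lambda>k. Poly_Mapping.single k 1) ` multilinear_monos (SIGMA g:supp. {..<ns g}))"
  proof -
    have fin: "finite (multilinear_monos (SIGMA g:supp. {..<ns g}))"
      by (intro finite_multilinear_monos finite_SigmaI finite_supp) simp
    then show "finite ((\<lambda>k. Poly_Mapping.single k (1::'f)) ` multilinear_monos (SIGMA g:supp. {..<ns g}))"
      by simp
    show "?V \<subseteq> pm.span ((\<lambda>k. Poly_Mapping.single k 1) ` multilinear_monos (SIGMA g:supp. {..<ns g}))"
      using pm_in_span_singles[OF fin] by (auto simp: P_space_def multilinear_polys_eq)
  qed (auto simp: W_def subspace_P_space subspace_graded_identities pm.subspace_inter)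
  have inv: "\<forall>\<sigma>\<in>?G. pm_push (map_mono (rename \<sigma>)) ` ?V \<subseteq> ?V"
    "\<forall>\<sigma>\<in>?G. pm_push (map_mono (rename \<sigma>)) ` W \<subseteq> W"
    using rename_P_space subgroup_H_group rename_graded_identities by (auto simp: W_def)
  obtain U where U: "finite U" "U \<subseteq> H.average ` ?V" "pm.independent U" "pm.span U \<inter> W = {0}"
    "H.average ` ?V \<subseteq> pm.span (U \<union> W)"
    "(\<Sum>\<sigma>\<in>?G. (\<Prod>g\<in>supp. \<epsilon> g (\<sigma> g)) / of_nat (card ?G)
       * pm.quotient_trace ?V W (pm_push (map_mono (rename \<sigma>)))) = of_nat (card U)"
    by (rule H.signed_trace[OF V inv]) (rule that)
  \<comment> \<open>\<open>r g \<mu>\<close> below is the dimension of the space of \<open>\<epsilon> g\<close>-vectors in the Young module of \<open>\<mu>\<close>.\<close>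
  define P where "P g \<mu> r \<longleftrightarrow> (\<Sum>\<sigma>\<in>G g. \<epsilon> g \<sigma> / of_nat (card (G g)) * irr_char \<mu> \<sigma>) = of_nat r
      \<and> (signed_action.average (G g) (\<epsilon> g) left_mult (young_symmetrizer \<mu>) \<noteq> 0 \<longrightarrow> r \<ge> 1)" for g \<mu> r
  have "\<exists>r. P g \<mu> r" if "g \<in> supp" "\<mu> \<in> partitions (ns g)" for g \<mu>
  proof -
    interpret sym_signed_subgroup "ns g" "G g" "\<epsilon> g"
      by (rule signed[OF that(1)])
    have "ns g = sum_list \<mu>"
      using that(2) by (simp add: partitions_def)
    then obtain r where "(\<Sum>\<sigma>\<in>G g. \<epsilon> g \<sigma> / of_nat (card (G g)) * irr_char \<mu> \<sigma>) = of_nat r"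
      "left.average (young_symmetrizer \<mu>) \<noteq> 0 \<Longrightarrow> r \<ge> 1"
      by (rule young_module_trace) (rule that)
    then show ?thesis
      unfolding P_def by blast
  qed
  then obtain r where r: "P g \<mu> (r g \<mu>)" if "g \<in> supp" "\<mu> \<in> partitions (ns g)" for g \<mu>
    by metis
  have part: "M g \<in> partitions (ns g)" if "M \<in> multipartitions ns" "g \<in> supp" for M g
    using that by (auto simp: multipartitions_def)
  have "of_nat (card U) = (\<Sum>\<sigma>\<in>?G. (\<Prod>g\<in>supp. \<epsilon> g (\<sigma> g) / of_nat (card (G g)))
      * (\<Sum>M\<in>multipartitions ns. of_nat (m M) * irr_char_H M \<sigma>))"
  proof -
    have "char_P ns \<sigma> = (\<Sum>M\<in>multipartitions ns. of_nat (m M) * irr_char_H M \<sigma>)" if "\<sigma> \<in> ?G" for \<sigma>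
      using m subgroup_H_group[OF that] by (auto simp: are_multiplicities_def)
    then show ?thesis
      unfolding U(6)[symmetric]
      by (intro sum.cong refl) (simp add: char_P_def W_def prod_dividef card_PiE finite_supp)
  qed
  also have "\<dots> = (\<Sum>M\<in>multipartitions ns. of_nat (m M) *
      (\<Sum>\<sigma>\<in>?G. \<Prod>g\<in>supp. \<epsilon> g (\<sigma> g) / of_nat (card (G g)) * irr_char (M g) (\<sigma> g)))"
    unfolding sum_distrib_left
    by (subst sum.swap) (simp only: irr_char_H_def prod.distrib mult_ac)
  also have "\<dots> = (\<Sum>M\<in>multipartitions ns. of_nat (m M) * (\<Prod>g\<in>supp. of_nat (r g (M g))))"
  proof (intro sum.cong refl arg_cong2[where f = "(*)"])
    fix M assume M: "M \<in> multipartitions ns"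
    have "(\<Sum>\<sigma>\<in>?G. \<Prod>g\<in>supp. \<epsilon> g (\<sigma> g) / of_nat (card (G g)) * irr_char (M g) (\<sigma> g))
        = (\<Prod>g\<in>supp. \<Sum>\<sigma>\<in>G g. \<epsilon> g \<sigma> / of_nat (card (G g)) * irr_char (M g) \<sigma>)"
      using finite_supp sym_signed_subgroup.finite_subgroup[OF signed] by (rule prod_sum_PiE[symmetric])
    also have "\<dots> = (\<Prod>g\<in>supp. of_nat (r g (M g)))"
      using r part[OF M] by (intro prod.cong refl) (auto simp: P_def)
    finally show "(\<Sum>\<sigma>\<in>?G. \<Prod>g\<in>supp. \<epsilon> g (\<sigma> g) / of_nat (card (G g)) * irr_char (M g) (\<sigma> g))
        = (\<Prod>g\<in>supp. of_nat (r g (M g)))" .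
  qed
  also have "\<dots> = of_nat (\<Sum>M\<in>multipartitions ns. m M * (\<Prod>g\<in>supp. r g (M g)))"
    by simp
  finally have card_U: "card U = (\<Sum>M\<in>multipartitions ns. m M * (\<Prod>g\<in>supp. r g (M g)))"
    unfolding of_nat_eq_iff .
  have "1 \<le> (\<Prod>g\<in>supp. r g (\<Lambda> g))"
    using r part[OF \<Lambda>] nonzero by (intro prod_ge_1) (auto simp: P_def)
  then have "m \<Lambda> \<le> m \<Lambda> * (\<Prod>g\<in>supp. r g (\<Lambda> g))"
    by simp
  also have "\<dots> \<le> card U"
    unfolding card_U by (intro member_le_sum \<Lambda> finite_multipartitions) auto
  finally have "m \<Lambda> \<le> card U" .
  then show ?thesis
    using that U(1-4) unfolding W_def by blast
qed

end


section \<open>Bounds for the multiplicities\<close>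

context finite_graded_algebra
begin

lemma finite_independent: "independent S \<Longrightarrow> finite S"
  using finite_dimensional independent_span_bound by (metis subset_UNIV)

definition component_basis :: "'g \<Rightarrow> 'a set" where
  "component_basis g = (SOME B. B \<subseteq> gr g \<and> independent B \<and> gr g \<subseteq> span B \<and> card B = dim (gr g))"

lemma component_basis:
  "gr g \<subseteq> span (component_basis g)" "card (component_basis g) = dim (gr g)"
  "finite (component_basis g)"
proof -
  have "\<exists>B. B \<subseteq> gr g \<and> independent B \<and> gr g \<subseteq> span B \<and> card B = dim (gr g)"
    using basis_exists[of "gr g"] by metis
  then have *: "component_basis g \<subseteq> gr g \<and> independent (component_basis g)
      \<and> gr g \<subseteq> span (component_basis g) \<and> card (component_basis g) = dim (gr g)"
    unfolding component_basis_def by (rule someI_ex)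
  then show "gr g \<subseteq> span (component_basis g)"
    "card (component_basis g) = dim (gr g)" "finite (component_basis g)"
    using finite_independent by blast+
qed

definition basis_assignments :: "('g \<Rightarrow> nat) \<Rightarrow> ('g \<times> nat \<Rightarrow> 'a) set" where
  "basis_assignments ns = {a. \<forall>g\<in>supp. \<forall>j<ns g. a (g, j) \<in> component_basis g}"

lemma graded_identity_if_zero_on_basis:
  assumes f: "f \<in> P_space ns" and zero: "\<And>a. a \<in> basis_assignments ns \<Longrightarrow> eval a f = 0"
  shows "f \<in> graded_identities"
  unfolding graded_identities_def
proof (intro CollectI allI impI)
  fix a :: "'g \<times> nat \<Rightarrow> 'a" assume a: "\<forall>g j. a (g, j) \<in> gr g"
  show "eval a f = 0"
  proof (rule eval_zero_of_spanning[where b = "\<lambda>x. component_basis (fst x)"])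
    show "f \<in> multilinear_polys (SIGMA g:supp. {..<ns g})"
      using f by (simp add: P_space_def)
    show "finite (SIGMA g:supp. {..<ns g})"
      using finite_supp by simp
    show "eval c f = 0" if "\<And>x. x \<in> (SIGMA g:supp. {..<ns g}) \<Longrightarrow> c x \<in> component_basis (fst x)" for c
      using that by (intro zero) (force simp: basis_assignments_def)
    show "a x \<in> span (component_basis (fst x))" for x
      using a component_basis(1)[of "fst x"] by (cases x) auto
  qed
qed

text \<open>
  If \<open>\<Lambda> g\<^sub>0\<close> has more rows than the dimension of the component of degree \<open>g\<^sub>0\<close>, then a basis
  assignment takes the same value on two variables of degree \<open>g\<^sub>0\<close> whose indices lie in the first
  column, so polynomials that are alternating in these variables vanish.
\<close>

lemma multiplicity_zero:
  assumes m: "are_multiplicities ns m" and \<Lambda>: "\<Lambda> \<in> multipartitions ns"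
    and g0: "g0 \<in> supp" "dim (gr g0) < length (\<Lambda> g0)"
  shows "m \<Lambda> = 0"
proof -
  let ?G = "\<lambda>g. column_stabilizer (\<Lambda> g)" and ?\<epsilon> = "\<lambda>_ \<tau>. of_int (sign \<tau>) :: 'f"
  have sum: "sum_list (\<Lambda> g) = ns g" "0 \<notin> set (\<Lambda> g)" if "g \<in> supp" for g
    using \<Lambda> that by (auto simp: multipartitions_def partitions_def)
  interpret S: signed_subgroups scale amul gop gr ns ?G ?\<epsilon>
    by (intro signed_subgroups.intro finite_graded_algebra_axioms signed_subgroups_axioms.intro)
       (use column_stabilizer_signed sum in metis)
  obtain U where U: "finite U" "U \<subseteq> S.H.average ` P_space ns" "pm.independent U"
    "pm.span U \<inter> (P_space ns \<inter> graded_identities) = {0}" "m \<Lambda> \<le> card U"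
    by (rule S.multiplicity_le_card[OF m \<Lambda> column_average_young_symmetrizer_nonzero]) (rule that)
  note inP = S.average_P_space
  have "S.H.average f \<in> graded_identities" if f: "f \<in> P_space ns" for f
  proof (rule graded_identity_if_zero_on_basis[OF inP[OF f]])
    fix a assume a: "a \<in> basis_assignments ns"
    let ?\<mu> = "\<Lambda> g0"
    have "\<forall>i<length ?\<mu>. \<exists>j<ns g0. box ?\<mu> j = (i, 0)"
      using box_first_column[of ?\<mu>] sum[OF g0(1)] by auto
    then obtain p where p: "p i < ns g0" "box ?\<mu> (p i) = (i, 0)" if "i < length ?\<mu>" for i
      by metis
    have "\<not> inj_on (\<lambda>i. a (g0, p i)) {..<length ?\<mu>}"
    proof (rule pigeonhole)
      have "(\<lambda>i. a (g0, p i)) ` {..<length ?\<mu>} \<subseteq> component_basis g0"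
        using a p g0 by (auto simp: basis_assignments_def)
      then have "card ((\<lambda>i. a (g0, p i)) ` {..<length ?\<mu>}) \<le> card (component_basis g0)"
        by (rule card_mono[OF component_basis(3)])
      then show "card ((\<lambda>i. a (g0, p i)) ` {..<length ?\<mu>}) < card {..<length ?\<mu>}"
        using g0(2) by (simp add: component_basis(2))
    qed
    then obtain i i' where i: "i < length ?\<mu>" "i' < length ?\<mu>" "i \<noteq> i'" "a (g0, p i) = a (g0, p i')"
      by (auto simp: inj_on_def)
    \<comment> \<open>Exchanging the two variables with equal values changes the sign of the polynomial, not its value.\<close>
    define t where "t = transpose (p i) (p i')"
    have ne: "p i \<noteq> p i'"
      using p(2)[OF i(1)] p(2)[OF i(2)] i(3) by auto
    have perm: "t permutes {..<ns g0}"
      unfolding t_def using p(1) i(1,2) by (intro permutes_swap_id) auto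
    have t_col: "t \<in> column_stabilizer ?\<mu>"
      using perm p(2)[OF i(1)] p(2)[OF i(2)]
      by (auto simp: column_stabilizer_def sym_group_def sum(1)[OF g0(1)] t_def transpose_def)
    define \<tau> where "\<tau> = (\<lambda>g\<in>supp. if g = g0 then t else id)"
    have id_col: "id \<in> column_stabilizer \<mu>" for \<mu>
      by (simp add: column_stabilizer_def sym_group_def permutes_id)
    have \<tau>: "\<tau> \<in> Pi\<^sub>E supp ?G"
      using t_col id_col by (auto simp: \<tau>_def)
    have "(\<Prod>g\<in>supp. of_int (sign (\<tau> g)) :: 'f) = (\<Prod>g\<in>supp. if g = g0 then - 1 else 1)"
      using ne by (intro prod.cong refl) (simp add: \<tau>_def t_def sign_swap_id)
    also have "\<dots> = - 1"
      using g0(1) finite_supp by simp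
    finally have "pm_push (map_mono (rename \<tau>)) (S.H.average f) = pm_scale (- 1) (S.H.average f)"
      using S.H.T_average[OF \<tau>] by simp
    then have "eval (a \<circ> rename \<tau>) (S.H.average f) = eval a (pm_scale (- 1) (S.H.average f))"
      by (simp flip: eval_pm_push)
    moreover have "a (rename \<tau> x) = a x" for x
      using i(4) by (cases x) (auto simp: rename_def \<tau>_def t_def transpose_def)
    then have "a \<circ> rename \<tau> = a"
      by auto
    moreover have "eval a (pm_scale (- 1) (S.H.average f)) = scale (- 1) (eval a (S.H.average f))"
      by (rule module_hom.scale) (simp add: module_hom_iff_linear linear_eval)
    \<comment> \<open>A value equal to its negative vanishes, as the characteristic is not 2.\<close>
    ultimately have "scale 1 (eval a (S.H.average f)) = scale (- 1) (eval a (S.H.average f))"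
      by simp
    then show "eval a (S.H.average f) = 0"
      unfolding scale_cancel_right by simp
  qed
  then have "U \<subseteq> P_space ns \<inter> graded_identities"
    using U(2) inP by auto
  then have "U \<subseteq> {0}"
    using U(4) pm.span_superset[of U] by blast
  then have "U = {}"
    using U(3) pm.dependent_zero[of U] by blast
  then show ?thesis
    using U(5) by simp
qed

text \<open>
  A polynomial that is symmetric in the variables of each row takes the same value on two basis
  assignments that use every basis element equally often in every row.  So its values on one
  assignment for each family of frequencies decide whether it is a graded identity.
\<close>

lemma multiplicity_le:
  assumes m: "are_multiplicities ns m" and \<Lambda>: "\<Lambda> \<in> multipartitions ns"
    and short: "\<And>g. g \<in> supp \<Longrightarrow> length (\<Lambda> g) \<le> dim (gr g)"
    and n: "\<And>g. g \<in> supp \<Longrightarrow> ns g \<le> n"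
  shows "m \<Lambda> \<le> dim (UNIV :: 'a set) * (n + 1) ^ (\<Sum>g\<in>supp. (dim (gr g))\<^sup>2)"
proof -
  let ?G = "\<lambda>g. row_stabilizer (\<Lambda> g)" and ?\<epsilon> = "\<lambda>(_::'g) (_::nat \<Rightarrow> nat). 1 :: 'f"
  have sum: "sum_list (\<Lambda> g) = ns g" if "g \<in> supp" for g
    using \<Lambda> that by (auto simp: multipartitions_def partitions_def)
  interpret S: signed_subgroups scale amul gop gr ns ?G ?\<epsilon>
    by (intro signed_subgroups.intro finite_graded_algebra_axioms signed_subgroups_axioms.intro)
       (use row_stabilizer_signed sum in metis)
  obtain U where U: "finite U" "U \<subseteq> S.H.average ` P_space ns" "pm.independent U"
    "pm.span U \<inter> (P_space ns \<inter> graded_identities) = {0}" "m \<Lambda> \<le> card U"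
    by (rule S.multiplicity_le_card[OF m \<Lambda> row_average_young_symmetrizer_nonzero]) (rule that)
  interpret av: Vector_Spaces.linear pm_scale pm_scale S.H.average
    by (rule S.H.linear_average)
  note inP = S.average_P_space
  define I where "I = (SIGMA g:supp. {..<dim (gr g)} \<times> component_basis g)"
  define freq where "freq a = (\<lambda>(g, i, b)\<in>I. card {j. j < ns g \<and> fst (box (\<Lambda> g) j) = i \<and> a (g, j) = b})"
    for a :: "'g \<times> nat \<Rightarrow> 'a"
  define K where "K = freq ` basis_assignments ns"
  have "finite I"
    unfolding I_def by (intro finite_SigmaI finite_cartesian_product finite_supp component_basis) simp
  have card_I: "card I = (\<Sum>g\<in>supp. (dim (gr g))\<^sup>2)"
    unfolding I_def using finite_supp
    by (subst card_SigmaI) (auto simp: component_basis(2,3) card_cartesian_product power2_eq_square)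
  have "K \<subseteq> Pi\<^sub>E I (\<lambda>_. {..n})"
  proof -
    have "card {j. j < ns g \<and> Q j} \<le> n" if "g \<in> supp" for g and Q :: "nat \<Rightarrow> bool"
    proof -
      have "card {j. j < ns g \<and> Q j} \<le> card {..<ns g}"
        by (rule card_mono) auto
      then show ?thesis
        using n[OF that] by simp
    qed
    then have "freq a \<in> Pi\<^sub>E I (\<lambda>_. {..n})" for a
      unfolding freq_def restrict_PiE_iff by (auto simp: I_def)
    then show ?thesis
      unfolding K_def by blast
  qed
  then have K: "finite K" "card K \<le> (n + 1) ^ (\<Sum>g\<in>supp. (dim (gr g))\<^sup>2)"
    using finite_PiE[OF \<open>finite I\<close>, of "\<lambda>_. {..n}"] card_mono[of "Pi\<^sub>E I (\<lambda>_. {..n})" K]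
    by (auto simp: finite_subset card_PiE \<open>finite I\<close> card_I)
  have same_freq: "eval a (S.H.average f) = eval a' (S.H.average f)"
    if a: "a \<in> basis_assignments ns" "a' \<in> basis_assignments ns" "freq a = freq a'" and f: "f \<in> P_space ns"
    for a a' f
  proof -
    have "\<exists>p. p \<in> row_stabilizer (\<Lambda> g) \<and> (\<forall>j<ns g. a (g, j) = a' (g, p j))" if g: "g \<in> supp" for g
    proof -
      let ?row = "\<lambda>j. fst (box (\<Lambda> g) j)"
      have "card {j. j < ns g \<and> ?row j = i \<and> a (g, j) = b} = card {j. j < ns g \<and> ?row j = i \<and> a' (g, j) = b}"
        for i b
      proof (cases "(g, i, b) \<in> I")
        case True
        then show ?thesis
          using fun_cong[OF a(3), of "(g, i, b)"] by (simp add: freq_def)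
      next
        case False
        \<comment> \<open>Only rows below the height of \<open>\<Lambda> g\<close> and values in the chosen basis occur, so both sides are 0.\<close>
        have "?row j < dim (gr g)" if "j < ns g" for j
          using box_row_lt[of j "\<Lambda> g"] short[OF g] sum[OF g] that by simp
        then have unused: "{j. j < ns g \<and> ?row j = i \<and> c (g, j) = b} = {}" if "c \<in> basis_assignments ns" for c
          using False that g by (auto simp: I_def basis_assignments_def)
        show ?thesis
          by (simp only: unused[OF a(1)] unused[OF a(2)])
      qed
      then have "image_mset (\<lambda>j. (?row j, a (g, j))) (mset_set {..<ns g})
          = image_mset (\<lambda>j. (?row j, a' (g, j))) (mset_set {..<ns g})"
        by (intro multiset_eqI)
           (auto simp: count_image_mset' sum.If_cases Int_def vimage_def conj_ac eq_commute)
      then obtain p where p: "p permutes {..<ns g}"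
        "\<forall>j\<in>{..<ns g}. (?row j, a (g, j)) = (?row (p j), a' (g, p j))"
        by (rule image_mset_eq_implies_permutes[rotated]) auto
      then have "p \<in> row_stabilizer (\<Lambda> g)" "\<forall>j<ns g. a (g, j) = a' (g, p j)"
        by (auto simp: row_stabilizer_def sym_group_def sum[OF g])
      then show ?thesis
        by blast
    qed
    then obtain p where p: "p g \<in> row_stabilizer (\<Lambda> g)" "\<forall>j<ns g. a (g, j) = a' (g, p g j)"
      if "g \<in> supp" for g
      by metis
    define \<tau> where "\<tau> = restrict p supp"
    have \<tau>: "\<tau> \<in> Pi\<^sub>E supp ?G"
      using p(1) by (simp add: \<tau>_def)
    have "eval a (S.H.average f) = eval (a' \<circ> rename \<tau>) (S.H.average f)"
    proof (rule eval_cong)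
      show "S.H.average f \<in> multilinear_polys (SIGMA g:supp. {..<ns g})"
        using inP[OF f] by (simp add: P_space_def)
      show "a x = (a' \<circ> rename \<tau>) x" if "x \<in> (SIGMA g:supp. {..<ns g})" for x
        using that p(2) by (auto simp: rename_def \<tau>_def)
    qed
    also have "\<dots> = eval a' (pm_push (map_mono (rename \<tau>)) (S.H.average f))"
      by (simp add: eval_pm_push)
    also have "\<dots> = eval a' (S.H.average f)"
      using S.H.T_average[OF \<tau>] by simp
    finally show ?thesis .
  qed
  \<comment> \<open>One assignment \<open>rep \<kappa>\<close> for each family \<open>\<kappa>\<close> of frequencies that occurs.\<close>
  define rep where "rep \<kappa> = (SOME a. a \<in> basis_assignments ns \<and> freq a = \<kappa>)" for \<kappa>
  have rep: "rep \<kappa> \<in> basis_assignments ns" "freq (rep \<kappa>) = \<kappa>" if "\<kappa> \<in> K" for \<kappa>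
  proof -
    have "\<exists>a. a \<in> basis_assignments ns \<and> freq a = \<kappa>"
      using that by (auto simp: K_def)
    from someI_ex[OF this] show "rep \<kappa> \<in> basis_assignments ns" "freq (rep \<kappa>) = \<kappa>"
      by (auto simp: rep_def)
  qed
  obtain B where B: "independent B" "UNIV \<subseteq> span B" "card B = dim (UNIV :: 'a set)"
    by (rule basis_exists)
  have "finite B"
    by (rule finite_independent[OF B(1)])
  \<comment> \<open>The coordinates of the values at these assignments separate the span of \<open>U\<close>.\<close>
  define \<phi> where "\<phi> = (\<lambda>(\<kappa>, b) f. representation B (eval (rep \<kappa>) f) b)"
  have "card U \<le> card (K \<times> B)"
  proof (rule pm.independent_card_le_functionals)
    show "finite (K \<times> B)"
      using K(1) \<open>finite B\<close> by simp
    show "Vector_Spaces.linear pm_scale (*) (\<phi> x)" if "x \<in> K \<times> B" for x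
    proof -
      have "\<phi> x = (\<lambda>v. representation B v (snd x)) \<circ> eval (rep (fst x))"
        by (auto simp: \<phi>_def split_beta)
      moreover have "span B = UNIV"
        using B(2) by blast
      ultimately show ?thesis
        using Vector_Spaces.linear_compose[OF linear_eval linear_representation[OF B(1)]] by simp
    qed
    fix v assume v: "v \<in> pm.span U" "\<And>x. x \<in> K \<times> B \<Longrightarrow> \<phi> x v = 0"
    have "pm.span U \<subseteq> S.H.average ` P_space ns"
      using U(2) by (intro pm.span_minimal av.subspace_image subspace_P_space)
    then obtain f where f: "f \<in> P_space ns" "v = S.H.average f"
      using v(1) by auto
    have "eval a v = 0" if a: "a \<in> basis_assignments ns" for a
    proof -
      have \<kappa>: "freq a \<in> K"
        using a by (simp add: K_def)
      have "representation B (eval (rep (freq a)) v) b = 0" for b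
        using v(2)[of "(freq a, b)"] \<kappa> representation_ne_zero[of B _ b] by (auto simp: \<phi>_def)
      then have "eval (rep (freq a)) v = 0"
        using sum_nonzero_representation_eq[OF B(1), of "eval (rep (freq a)) v"] B(2) by auto
      then show ?thesis
        using same_freq[OF a rep(1)[OF \<kappa>] _ f(1)] rep(2)[OF \<kappa>] f(2) by simp
    qed
    then have "v \<in> graded_identities"
      using inP[OF f(1)] f(2) by (intro graded_identity_if_zero_on_basis) auto
    then show "v = 0"
      using U(4) v(1) inP[OF f(1)] f(2) by blast
  qed (rule U(3))
  also have "\<dots> \<le> dim (UNIV :: 'a set) * (n + 1) ^ (\<Sum>g\<in>supp. (dim (gr g))\<^sup>2)"
    using K(2) by (simp add: card_cartesian_product B(3))
  finally show ?thesis
    using U(5) by simp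
qed


section \<open>The bound for the colength\<close>

text \<open>
  A partition of \<open>n\<close> with at most \<open>l\<close> parts is a list of length at most \<open>l\<close> over \<open>{1..n}\<close>; the
  order of the parts is ignored in the count.
\<close>

lemma card_short_partitions:
  "card {\<mu> \<in> partitions n. length \<mu> \<le> l} \<le> (n + 1) ^ l"
proof -
  have "card {\<mu> \<in> partitions n. length \<mu> \<le> l} \<le> card {\<mu>. set \<mu> \<subseteq> {1..n} \<and> length \<mu> \<le> l}"
  proof (rule card_mono)
    show "finite {\<mu>. set \<mu> \<subseteq> {1..n} \<and> length \<mu> \<le> l}"
      by (rule finite_lists_length_le) simp
    have "1 \<le> x \<and> x \<le> n" if "\<mu> \<in> partitions n" "x \<in> set \<mu>" for \<mu> x
      using that member_le_sum_list[of x \<mu>] by (cases x) (auto simp: partitions_def)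
    then show "{\<mu> \<in> partitions n. length \<mu> \<le> l} \<subseteq> {\<mu>. set \<mu> \<subseteq> {1..n} \<and> length \<mu> \<le> l}"
      by auto
  qed
  also have "\<dots> = (\<Sum>i\<le>l. n ^ i)"
    by (subst card_lists_length_le) auto
  also have "\<dots> \<le> (n + 1) ^ l"
  proof (induction l)
    case (Suc l)
    have "(\<Sum>i\<le>Suc l. n ^ i) = 1 + n * (\<Sum>i\<le>l. n ^ i)"
      by (simp add: sum.atMost_Suc_shift sum_distrib_left del: sum.atMost_Suc)
    also have "\<dots> \<le> (n + 1) ^ l + n * (n + 1) ^ l"
      using Suc by (intro add_mono mult_left_mono) auto
    finally show ?case
      by simp
  qed simp
  finally show ?thesis .
qed

lemma compositions_le: "ns \<in> compositions n \<Longrightarrow> g \<in> supp \<Longrightarrow> ns g \<le> n"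
  using member_le_sum[of g supp ns] finite_supp by (auto simp: compositions_def)

text \<open>
  Only the tuples with at most \<open>dim (gr g)\<close> rows in each component \<open>g\<close> contribute, and each of
  them contributes at most the bound above.
\<close>

lemma partial_colength_le:
  assumes ns: "ns \<in> compositions n"
  shows "partial_colength ns \<le>
    dim (UNIV :: 'a set) * (n + 1) ^ ((\<Sum>g\<in>supp. (dim (gr g))\<^sup>2) + (\<Sum>g\<in>supp. dim (gr g)))"
proof (cases "\<exists>m. are_multiplicities ns m")
  case False
  \<comment> \<open>Then \<open>multiplicity ns\<close> takes its default value 0.\<close>
  then show ?thesis
    by (simp add: partial_colength_def multiplicity_def)
next
  case True
  then have m: "are_multiplicities ns (multiplicity ns)"
    by (simp add: multiplicity_def someI_ex)
  let ?S = "Pi\<^sub>E supp (\<lambda>g. {\<mu> \<in> partitions (ns g). length \<mu> \<le> dim (gr g)})"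
  let ?c = "dim (UNIV :: 'a set) * (n + 1) ^ (\<Sum>g\<in>supp. (dim (gr g))\<^sup>2)"
  have S: "?S \<subseteq> multipartitions ns" "finite (multipartitions ns)"
    using finite_PiE[OF finite_supp finite_partitions] by (auto simp: multipartitions_def PiE_iff)
  have zero: "multiplicity ns \<Lambda> = 0" if "\<Lambda> \<in> multipartitions ns - ?S" for \<Lambda>
  proof -
    have "\<exists>g\<in>supp. \<not> length (\<Lambda> g) \<le> dim (gr g)"
      using that by (auto simp: multipartitions_def PiE_iff)
    then obtain g where "g \<in> supp" "dim (gr g) < length (\<Lambda> g)"
      unfolding not_le by blast
    then show ?thesis
      using multiplicity_zero[OF m] that by blast
  qed
  have "partial_colength ns = (\<Sum>\<Lambda>\<in>?S. multiplicity ns \<Lambda>)"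
    unfolding partial_colength_def using S zero by (intro sum.mono_neutral_right) auto
  also have "\<dots> \<le> (\<Sum>\<Lambda>\<in>?S. ?c)"
  proof (rule sum_mono)
    fix \<Lambda> assume \<Lambda>: "\<Lambda> \<in> ?S"
    show "multiplicity ns \<Lambda> \<le> ?c"
    proof (rule multiplicity_le[OF m])
      show "\<Lambda> \<in> multipartitions ns"
        using \<Lambda> S(1) by blast
      show "length (\<Lambda> g) \<le> dim (gr g)" if "g \<in> supp" for g
        using PiE_mem[OF \<Lambda> that] by simp
    qed (rule compositions_le[OF ns])
  qed
  also have "\<dots> = card ?S * ?c"
    by simp
  also have "card ?S \<le> (\<Prod>g\<in>supp. (n + 1) ^ dim (gr g))"
    unfolding card_PiE[OF finite_supp]
  proof (intro prod_mono conjI)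
    fix g assume "g \<in> supp"
    have "card {\<mu> \<in> partitions (ns g). length \<mu> \<le> dim (gr g)} \<le> (ns g + 1) ^ dim (gr g)"
      by (rule card_short_partitions)
    also have "\<dots> \<le> (n + 1) ^ dim (gr g)"
      using compositions_le[OF ns \<open>g \<in> supp\<close>] by (intro power_mono) auto
    finally show "card {\<mu> \<in> partitions (ns g). length \<mu> \<le> dim (gr g)} \<le> (n + 1) ^ dim (gr g)" .
  qed simp
  also have "\<dots> = (n + 1) ^ (\<Sum>g\<in>supp. dim (gr g))"
    by (simp add: power_sum)
  finally show ?thesis
    by (simp add: power_add mult_ac)
qed

lemma card_compositions: "card (compositions n) \<le> (n + 1) ^ card supp"
proof -
  have "compositions n \<subseteq> Pi\<^sub>E supp (\<lambda>_. {..n})"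
  proof
    fix ns assume ns: "ns \<in> compositions n"
    then have "ns \<in> extensional supp"
      by (simp add: compositions_def PiE_iff)
    with compositions_le[OF ns] show "ns \<in> Pi\<^sub>E supp (\<lambda>_. {..n})"
      by (simp add: PiE_iff)
  qed
  then have "card (compositions n) \<le> card (Pi\<^sub>E supp (\<lambda>_. {..n}))"
    by (intro card_mono finite_PiE finite_supp) auto
  then show ?thesis
    by (simp add: card_PiE finite_supp)
qed

lemma graded_colength_le:
  "graded_colength n \<le> dim (UNIV :: 'a set)
     * (n + 1) ^ (card supp + (\<Sum>g\<in>supp. (dim (gr g))\<^sup>2) + (\<Sum>g\<in>supp. dim (gr g)))"
proof -
  let ?c = "dim (UNIV :: 'a set) * (n + 1) ^ ((\<Sum>g\<in>supp. (dim (gr g))\<^sup>2) + (\<Sum>g\<in>supp. dim (gr g)))"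
  have "graded_colength n \<le> (\<Sum>ns\<in>compositions n. ?c)"
    unfolding graded_colength_def by (intro sum_mono partial_colength_le)
  also have "\<dots> = card (compositions n) * ?c"
    by simp
  also have "\<dots> \<le> (n + 1) ^ card supp * ?c"
    by (intro mult_right_mono card_compositions) simp
  finally show ?thesis
    by (simp add: power_add mult_ac)
qed

end

theorem theorem1:
  fixes scale :: "'f::field_char_0 \<Rightarrow> 'a::ab_group_add \<Rightarrow> 'a"
    and amul :: "'a \<Rightarrow> 'a \<Rightarrow> 'a"
    and gop :: "'g \<Rightarrow> 'g \<Rightarrow> 'g"
    and gr :: "'g \<Rightarrow> 'a set"
    and gs :: "nat \<Rightarrow> 'g"
    and d :: "nat \<Rightarrow> nat"
    and k n :: nat
  assumes "graded_algebra scale amul gop gr"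
    and finite_dimensional: "\<exists>B. finite B \<and> module.span scale B = (UNIV :: 'a set)"
    and support: "bij_betw gs {1..k} (graded_algebra.supp gr)"
    and dims: "\<And>i. i \<in> {1..k} \<Longrightarrow> d i = vector_space.dim scale (gr (gs i))"
    and "n \<ge> 1"
  shows "graded_algebra.graded_colength scale amul gr n
           \<le> vector_space.dim scale (UNIV :: 'a set)
              * (n + 1) ^ (k + (\<Sum>i=1..k. (d i)\<^sup>2) + (\<Sum>i=1..k. d i))"
proof -
  interpret graded_algebra scale amul gop gr
    by (rule assms(1))
  have supp: "finite supp" "card supp = k"
    using bij_betw_finite[OF support] bij_betw_same_card[OF support] by auto
  interpret finite_graded_algebra scale amul gop gr
    by unfold_locales (use finite_dimensional supp(1) in auto)
  have "(\<Sum>i=1..k. (d i)\<^sup>2) = (\<Sum>g\<in>supp. (dim (gr g))\<^sup>2)" "(\<Sum>i=1..k. d i) = (\<Sum>g\<in>supp. dim (gr g))"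
    using dims by (simp_all flip: sum.reindex_bij_betw[OF support])
  then show ?thesis
    using graded_colength_le[of n] supp(2) by simp
qed

end
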